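(* The dual space $J^*$ of James' space $J$ has the W.A.P. (weakly compact approximation property).
   Context: James' space $J$ is the Banach space of real sequences $x=(x_j)_{j\ge 1}$ with $\lim_{j\to\infty}x_j=0$ and $$\|x\|^2=\sup\sum_{j=1}^n |x_{p_{j+1}}-x_{p_j}|^2<\infty,$$ where the supremum is over all $n\in\mathbb N$ and all indices $1\le p_1<p_2<\dots<p_n<p_{n+1}$; $\|\cdot\|$ is its norm. A Banach space $E$ has the weakly compact approximation property (W.A.P.) if there is a constant $C<\infty$ such that for every weakly compact set $D\subset E$ and every $\varepsilon>0$ there is a weakly compact operator $V:E\to E$ with $\sup_{x\in D}\|x-Vx\|<\varepsilon$ and $\|V\|\le C$. *)

theory Defs
  imports "HOL-Analysis.Analysis"
begin

section \<open>James' space\<close>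

text \<open>
  Sequences are indexed by \<open>nat\<close> from 0 rather than from 1.  In \<open>james_sums x\<close> the indices
  of a sum are \<open>p 0 < \<dots> < p n\<close> instead of the usual \<open>p\<^sub>1 < \<dots> < p\<^bsub>n+1\<^esub>\<close>; the value \<open>n = 0\<close> only contributes the sum 0,
  which does not change the supremum.
\<close>

definition james_sums :: "(nat \<Rightarrow> real) \<Rightarrow> real set" where
  "james_sums x =
    {(\<Sum>j<n. \<bar>x (p (Suc j)) - x (p j)\<bar>\<^sup>2) | (n::nat) p. strict_mono_on {..n} p}"

definition james_space :: "(nat \<Rightarrow> real) set" where
  "james_space = {x. x \<longlonglongrightarrow> 0 \<and> bdd_above (james_sums x)}"

definition james_norm :: "(nat \<Rightarrow> real) \<Rightarrow> real" where
  "james_norm x = sqrt (Sup (james_sums x))"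

lemma zero_in_james_sums: "0 \<in> james_sums x"
  unfolding james_sums_def by (auto intro!: exI[of _ 0] exI[of _ id] simp: strict_mono_on_def)

lemma james_norm_nonneg: "bdd_above (james_sums x) \<Longrightarrow> 0 \<le> james_norm x"
  unfolding james_norm_def using cSup_upper[OF zero_in_james_sums] by simp

lemma james_sums_L2:
  "(\<Sum>j<n. \<bar>x (p (Suc j)) - x (p j)\<bar>\<^sup>2) = (L2_set (\<lambda>j. x (p (Suc j)) - x (p j)) {..<n})\<^sup>2"
  for x :: "nat \<Rightarrow> real"
  unfolding L2_set_def by (simp add: sum_nonneg)

lemma james_norm_upper:
  assumes "bdd_above (james_sums x)" "strict_mono_on {..n} p"
  shows "L2_set (\<lambda>j. x (p (Suc j)) - x (p j)) {..<n} \<le> james_norm x"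
proof -
  have "(L2_set (\<lambda>j. x (p (Suc j)) - x (p j)) {..<n})\<^sup>2 \<le> Sup (james_sums x)"
    unfolding james_sums_L2[symmetric]
    by (rule cSup_upper) (use assms in \<open>auto simp: james_sums_def\<close>)
  then show ?thesis
    unfolding james_norm_def by (rule real_le_rsqrt)
qed

lemma james_norm_least:
  assumes "0 \<le> B"
    and "\<And>n p. strict_mono_on {..n} p \<Longrightarrow> L2_set (\<lambda>j. x (p (Suc j)) - x (p j)) {..<n} \<le> B"
  shows "bdd_above (james_sums x)" "james_norm x \<le> B"
proof -
  have *: "s \<le> B\<^sup>2" if "s \<in> james_sums x" for s
    using that assms unfolding james_sums_def james_sums_L2 by (auto intro!: power_mono)
  then show "bdd_above (james_sums x)"
    by (auto simp: bdd_above_def)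
  have "Sup (james_sums x) \<le> B\<^sup>2"
    using zero_in_james_sums * by (intro cSup_least) auto
  then show "james_norm x \<le> B"
    unfolding james_norm_def using assms(1) by (simp add: real_le_lsqrt)
qed

lemma james_add:
  assumes "bdd_above (james_sums x)" "bdd_above (james_sums y)"
  shows "bdd_above (james_sums (\<lambda>j. x j + y j))"
    "james_norm (\<lambda>j. x j + y j) \<le> james_norm x + james_norm y"
proof -
  have *: "L2_set (\<lambda>j. (x (p (Suc j)) + y (p (Suc j))) - (x (p j) + y (p j))) {..<n}
      \<le> james_norm x + james_norm y" if "strict_mono_on {..n} p" for n p
  proof -
    have "L2_set (\<lambda>j. (x (p (Suc j)) + y (p (Suc j))) - (x (p j) + y (p j))) {..<n}
      = L2_set (\<lambda>j. (x (p (Suc j)) - x (p j)) + (y (p (Suc j)) - y (p j))) {..<n}"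
      by (rule L2_set_cong) auto
    also have "\<dots> \<le> L2_set (\<lambda>j. x (p (Suc j)) - x (p j)) {..<n} + L2_set (\<lambda>j. y (p (Suc j)) - y (p j)) {..<n}"
      by (rule L2_set_triangle_ineq)
    also have "\<dots> \<le> james_norm x + james_norm y"
      by (intro add_mono james_norm_upper assms that)
    finally show ?thesis .
  qed
  have "0 \<le> james_norm x + james_norm y"
    using assms james_norm_nonneg by simp
  from james_norm_least[where x = "\<lambda>j. x j + y j", OF this *]
  show "bdd_above (james_sums (\<lambda>j. x j + y j))"
    "james_norm (\<lambda>j. x j + y j) \<le> james_norm x + james_norm y"
    by auto
qed

lemma james_scale_le:
  assumes "bdd_above (james_sums x)"
  shows "bdd_above (james_sums (\<lambda>j. c * x j))" "james_norm (\<lambda>j. c * x j) \<le> \<bar>c\<bar> * james_norm x"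
proof -
  have *: "L2_set (\<lambda>j. c * x (p (Suc j)) - c * x (p j)) {..<n} \<le> \<bar>c\<bar> * james_norm x"
    if "strict_mono_on {..n} p" for n p
  proof -
    have "L2_set (\<lambda>j. c * x (p (Suc j)) - c * x (p j)) {..<n}
       = \<bar>c\<bar> * L2_set (\<lambda>j. x (p (Suc j)) - x (p j)) {..<n}"
      unfolding L2_set_def
      by (simp flip: right_diff_distrib sum_distrib_left add: power_mult_distrib real_sqrt_mult)
    also have "\<dots> \<le> \<bar>c\<bar> * james_norm x"
      by (intro mult_left_mono james_norm_upper assms that) auto
    finally show ?thesis .
  qed
  have "0 \<le> \<bar>c\<bar> * james_norm x"
    using assms james_norm_nonneg by simp
  from james_norm_least[where x = "\<lambda>j. c * x j", OF this *]
  show "bdd_above (james_sums (\<lambda>j. c * x j))" "james_norm (\<lambda>j. c * x j) \<le> \<bar>c\<bar> * james_norm x"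
    by auto
qed

lemma james_norm_scale:
  assumes "bdd_above (james_sums x)"
  shows "james_norm (\<lambda>j. c * x j) = \<bar>c\<bar> * james_norm x"
proof (cases "c = 0")
  case True
  then show ?thesis
    using james_scale_le[OF assms, of c] james_norm_nonneg[OF james_scale_le(1)[OF assms, of c]] by simp
next
  case False
  have "james_norm (\<lambda>j. inverse c * (c * x j)) \<le> \<bar>inverse c\<bar> * james_norm (\<lambda>j. c * x j)"
    by (intro james_scale_le assms)
  then have "james_norm x \<le> \<bar>inverse c\<bar> * james_norm (\<lambda>j. c * x j)"
    using False by (simp add: mult.assoc[symmetric])
  then have "\<bar>c\<bar> * james_norm x \<le> james_norm (\<lambda>j. c * x j)"
    using False by (simp add: field_simps abs_inverse)
  then show ?thesis
    using james_scale_le[OF assms, of c] by simp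
qed

lemma james_diff_le_norm:
  assumes "bdd_above (james_sums x)"
  shows "\<bar>x i - x k\<bar> \<le> james_norm x"
proof -
  have *: "\<bar>x i - x k\<bar> \<le> james_norm x" if "k < i" for i k
  proof -
    define p where "p = (\<lambda>j::nat. if j = 0 then k else i)"
    have "strict_mono_on {..1} p"
      using that by (auto simp: strict_mono_on_def p_def)
    from james_norm_upper[OF assms this] show ?thesis
      by (simp add: p_def L2_set_def)
  qed
  show ?thesis
    using *[of k i] *[of i k] james_norm_nonneg[OF assms]
    by (cases i k rule: linorder_cases) (auto simp: abs_minus_commute)
qed

lemma james_coord_le_norm:
  assumes "x \<in> james_space"
  shows "\<bar>x i\<bar> \<le> james_norm x"
proof -
  have x: "x \<longlonglongrightarrow> 0" and b: "bdd_above (james_sums x)"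
    using assms by (auto simp: james_space_def)
  have "(\<lambda>k. \<bar>x i - x k\<bar>) \<longlonglongrightarrow> \<bar>x i - 0\<bar>"
    by (intro tendsto_intros x)
  then have "\<bar>x i - 0\<bar> \<le> james_norm x"
    by (rule LIMSEQ_le_const2) (use james_diff_le_norm[OF b] in auto)
  then show ?thesis
    by simp
qed

lemma james_sums_zero: "james_sums (\<lambda>_. 0) = {0}"
  using zero_in_james_sums[of "\<lambda>_. 0"] unfolding james_sums_def by auto

lemma james_norm_zero: "james_norm (\<lambda>_. 0) = 0"
  by (simp add: james_norm_def james_sums_zero)

typedef james = james_space
  morphisms james_apply James
proof
  show "(\<lambda>_. 0) \<in> james_space"
    by (simp add: james_space_def james_sums_zero)
qed

setup_lifting type_definition_james

lemma james_space_add: "x \<in> james_space \<Longrightarrow> y \<in> james_space \<Longrightarrow> (\<lambda>j. x j + y j) \<in> james_space"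
  unfolding james_space_def by (auto intro: james_add tendsto_add_zero)

lemma james_space_scale: "x \<in> james_space \<Longrightarrow> (\<lambda>j. c * x j) \<in> james_space"
  unfolding james_space_def by (auto intro: james_scale_le tendsto_mult_right_zero)

lemma james_space_diff: "x \<in> james_space \<Longrightarrow> y \<in> james_space \<Longrightarrow> (\<lambda>j. x j - y j) \<in> james_space"
  using james_space_add[OF _ james_space_scale[of y "-1"], of x] by simp

instantiation james :: real_vector
begin

lift_definition zero_james :: james is "\<lambda>_. 0"
  using james_space_scale[OF james_apply, of 0] by simp

lift_definition plus_james :: "james \<Rightarrow> james \<Rightarrow> james" is "\<lambda>x y j. x j + y j"
  by (rule james_space_add)

lift_definition minus_james :: "james \<Rightarrow> james \<Rightarrow> james" is "\<lambda>x y j. x j - y j"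
  by (rule james_space_diff)

lift_definition uminus_james :: "james \<Rightarrow> james" is "\<lambda>x j. - x j"
  using james_space_scale[of _ "-1"] by simp

lift_definition scaleR_james :: "real \<Rightarrow> james \<Rightarrow> james" is "\<lambda>c x j. c * x j"
  by (rule james_space_scale)

instance
  by standard (transfer; simp add: algebra_simps)+

end

instantiation james :: real_normed_vector
begin

lift_definition norm_james :: "james \<Rightarrow> real" is james_norm .

definition dist_james :: "james \<Rightarrow> james \<Rightarrow> real" where
  "dist_james x y = norm (x - y)"

definition sgn_james :: "james \<Rightarrow> james" where
  "sgn_james x = x /\<^sub>R norm x"

definition uniformity_james :: "(james \<times> james) filter" where
  "uniformity_james = (INF e\<in>{0<..}. principal {(x, y). dist x y < e})"

definition open_james :: "james set \<Rightarrow> bool" where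
  "open_james U \<longleftrightarrow> (\<forall>x\<in>U. \<forall>\<^sub>F (x', y) in uniformity. x' = x \<longrightarrow> y \<in> U)"

instance
proof
  fix x y :: james and a :: real
  show "dist x y = norm (x - y)" by (rule dist_james_def)
  show "sgn x = x /\<^sub>R norm x" by (rule sgn_james_def)
  show "uniformity = (INF e\<in>{0<..}. principal {(x, y). dist (x::james) y < e})"
    by (rule uniformity_james_def)
  show "open U \<longleftrightarrow> (\<forall>x\<in>U. \<forall>\<^sub>F (x', y) in uniformity. x' = x \<longrightarrow> y \<in> U)" for U :: "james set"
    by (rule open_james_def)
  show "norm (x + y) \<le> norm x + norm y"
    by transfer (auto simp: james_space_def intro: james_add)
  show scale: "norm (a *\<^sub>R x) = \<bar>a\<bar> * norm x"
    by transfer (auto simp: james_space_def james_norm_scale)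
  show "norm x = 0 \<longleftrightarrow> x = 0"
  proof
    show "norm x = 0 \<Longrightarrow> x = 0"
      by transfer (use james_coord_le_norm in fastforce)
    have "norm (0 :: james) = 0"
      by transfer (rule james_norm_zero)
    then show "x = 0 \<Longrightarrow> norm x = 0"
      by simp
  qed
qed

end

instance james :: banach
proof
  fix X :: "nat \<Rightarrow> james"
  assume C: "Cauchy X"
  let ?f = "\<lambda>m. james_apply (X m)"
  have mem: "?f m \<in> james_space" for m
    by (rule james_apply)
  have norm_diff: "norm (X m - X n) = james_norm (\<lambda>j. ?f m j - ?f n j)" for m n
    by transfer simp
  have coord: "\<bar>?f m j - ?f n j\<bar> \<le> norm (X m - X n)" for m n j
    unfolding norm_diff by (rule james_coord_le_norm) (intro james_space_diff mem)
  have "Cauchy (\<lambda>m. ?f m j)" for j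
  proof (rule CauchyI)
    fix e :: real assume "0 < e"
    with C obtain M where "\<forall>m\<ge>M. \<forall>n\<ge>M. norm (X m - X n) < e"
      by (auto simp: Cauchy_iff)
    then show "\<exists>M. \<forall>m\<ge>M. \<forall>n\<ge>M. norm (?f m j - ?f n j) < e"
      using coord by (metis order.strict_trans1 real_norm_def)
  qed
  then have "\<exists>l. (\<lambda>m. ?f m j) \<longlonglongrightarrow> l" for j
    by (simp add: Cauchy_convergent_iff convergent_def)
  then obtain l where l: "\<And>j. (\<lambda>m. ?f m j) \<longlonglongrightarrow> l j"
    by metis
  have close: "\<exists>M. \<forall>m\<ge>M. bdd_above (james_sums (\<lambda>j. ?f m j - l j)) \<and>
      james_norm (\<lambda>j. ?f m j - l j) \<le> e \<and> (\<forall>j. \<bar>?f m j - l j\<bar> \<le> e)" if "0 < e" for e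
  proof -
    obtain M where M: "\<And>m n. m \<ge> M \<Longrightarrow> n \<ge> M \<Longrightarrow> norm (X m - X n) < e"
      using C \<open>0 < e\<close> unfolding Cauchy_iff by blast
    have "L2_set (\<lambda>j. (?f m (p (Suc j)) - l (p (Suc j))) - (?f m (p j) - l (p j))) {..<k} \<le> e"
      if "m \<ge> M" "strict_mono_on {..k} p" for m k p
    proof (rule LIMSEQ_le_const2)
      show "(\<lambda>n. L2_set (\<lambda>j. (?f m (p (Suc j)) - ?f n (p (Suc j))) - (?f m (p j) - ?f n (p j))) {..<k})
        \<longlonglongrightarrow> L2_set (\<lambda>j. (?f m (p (Suc j)) - l (p (Suc j))) - (?f m (p j) - l (p j))) {..<k}"
        unfolding L2_set_def by (intro tendsto_intros l)
      have "L2_set (\<lambda>j. (?f m (p (Suc j)) - ?f n (p (Suc j))) - (?f m (p j) - ?f n (p j))) {..<k} \<le> e"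
        if "n \<ge> M" for n
      proof -
        have "bdd_above (james_sums (\<lambda>j. ?f m j - ?f n j))"
          using james_space_diff[OF mem mem, of m n] by (simp add: james_space_def)
        from james_norm_upper[OF this \<open>strict_mono_on {..k} p\<close>] M[OF \<open>m \<ge> M\<close> \<open>n \<ge> M\<close>]
        show ?thesis
          unfolding norm_diff by linarith
      qed
      then show "\<exists>N. \<forall>n\<ge>N. L2_set (\<lambda>j. (?f m (p (Suc j)) - ?f n (p (Suc j))) - (?f m (p j) - ?f n (p j))) {..<k} \<le> e"
        by blast
    qed
    then have "bdd_above (james_sums (\<lambda>j. ?f m j - l j)) \<and> james_norm (\<lambda>j. ?f m j - l j) \<le> e"
      if "m \<ge> M" for m
      using james_norm_least[where x = "\<lambda>j. ?f m j - l j" and B = e] \<open>0 < e\<close> that by simp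
    moreover
    have "\<bar>?f m j - l j\<bar> \<le> e" if "m \<ge> M" for m j
    proof (rule LIMSEQ_le_const2)
      show "(\<lambda>n. \<bar>?f m j - ?f n j\<bar>) \<longlonglongrightarrow> \<bar>?f m j - l j\<bar>"
        by (intro tendsto_intros l)
      show "\<exists>N. \<forall>n\<ge>N. \<bar>?f m j - ?f n j\<bar> \<le> e"
        using M[OF that] coord by (meson less_imp_le order_trans)
    qed
    ultimately show ?thesis
      by (intro exI[of _ M]) simp
  qed
  have "l \<longlonglongrightarrow> 0"
  proof (rule LIMSEQ_I)
    fix e :: real assume "0 < e"
    then obtain m where m: "\<And>j. \<bar>?f m j - l j\<bar> \<le> e / 2"
      using close[of "e / 2"] by auto
    have "?f m \<longlonglongrightarrow> 0"
      using mem by (simp add: james_space_def)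
    then obtain N where "\<forall>j\<ge>N. \<bar>?f m j\<bar> < e / 2"
      using \<open>0 < e\<close> LIMSEQ_D[of "?f m" 0 "e / 2"] by auto
    then have "\<bar>?f m j\<bar> < e / 2" if "j \<ge> N" for j
      using that by blast
    then have "\<bar>l j\<bar> < e" if "j \<ge> N" for j
      using m[of j] that by (smt (verit) field_sum_of_halves)
    then show "\<exists>N. \<forall>j\<ge>N. norm (l j - 0) < e"
      by auto
  qed
  moreover have "bdd_above (james_sums l)"
  proof -
    obtain m where b: "bdd_above (james_sums (\<lambda>j. ?f m j - l j))"
      using close[of 1] by auto
    have "bdd_above (james_sums (\<lambda>j. ?f m j + (-1) * (?f m j - l j)))"
      using mem[of m] by (intro james_add james_scale_le b) (auto simp: james_space_def)
    then show ?thesis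
      by simp
  qed
  ultimately have "l \<in> james_space"
    by (simp add: james_space_def)
  then have "norm (X m - James l) = james_norm (\<lambda>j. ?f m j - l j)" for m
    by (simp add: norm_james.rep_eq minus_james.rep_eq James_inverse)
  then have "X \<longlonglongrightarrow> James l"
    using close by (intro LIMSEQ_I) (metis dense order.strict_trans1)
  then show "convergent X"
    by (rule convergentI)
qed

section \<open>The weakly compact approximation property\<close>

definition weak_topology :: "'a::real_normed_vector topology" where
  "weak_topology =
    topology_generated_by {blinfun_apply f -` U | (f :: 'a \<Rightarrow>\<^sub>L real) U. open U}"

definition weakly_compact :: "'a::real_normed_vector set \<Rightarrow> bool" where
  "weakly_compact D \<longleftrightarrow> compactin weak_topology D"

definition weakly_compact_operator ::
    "('a::real_normed_vector \<Rightarrow>\<^sub>L 'b::real_normed_vector) \<Rightarrow> bool" where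
  "weakly_compact_operator V \<longleftrightarrow>
    weakly_compact (weak_topology closure_of (blinfun_apply V ` cball 0 1))"

text \<open>
  The supremum is taken in \<open>ereal\<close>, so that it is meaningful without a boundedness side
  condition; for \<open>D = {}\<close> it is \<open>-\<infinity>\<close> and the condition holds trivially.
\<close>

definition WAP :: "'a::banach itself \<Rightarrow> bool" where
  "WAP (_ :: 'a itself) \<longleftrightarrow>
    (\<exists>C::real. \<forall>D :: 'a set. weakly_compact D \<longrightarrow>
      (\<forall>\<epsilon>::real. \<epsilon> > 0 \<longrightarrow>
        (\<exists>V :: 'a \<Rightarrow>\<^sub>L 'a. weakly_compact_operator V \<and>
          (SUP x\<in>D. ereal (norm (x - blinfun_apply V x))) < ereal \<epsilon> \<and>
          norm V \<le> C)))"

end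

(* The idea: J** is J plus the line spanned by the constant sequence 1, which acts on J* as the
   limit L f = lim f(s_n), where s_n is the indicator of the first n indices.  On a weakly compact
   D, suitable averages u_0, u_1, ... of successive blocks of the s_n satisfy f(u_k) -> L f as
   rapidly as desired, uniformly in f in D.  The operator T x = sum_k x_k (u_(k+1) - u_k) on J is
   bounded with norm at most 4, because it interpolates x monotonically.  By the choice of the u_k,
   f o T is small for f in D, while T** fixes 1 modulo J, so (id - T)** maps J** into J.  Hence
   V f = f - f o T is weakly compact, close to the identity on D, and of norm at most 5. *)

theory Submission
  imports Defs
begin

section \<open>Square variation\<close>

text \<open>The steps themselves do not suffice: the functionals
  \<open>coord k - coord (Suc k)\<close> tend weakly to 0, yet the k-th one equals 1 at
  \<open>step (Suc k)\<close>, so the steps do not converge to the limit uniformly on weakly compact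
  sets. Averaging helps because signed sums of \<open>n\<close> bounded vectors with successive
  supports have norm of order \<open>sqrt n\<close> only. The same slow growth makes the unit vector
  basis shrinking, and this yields the description of the bidual. Rapid convergence is needed
  because \<open>f (T x)\<close> is the sum of the terms
  \<open>x k * (f (u (Suc k)) - f (u k))\<close>, and each \<open>x k\<close> is estimated merely by
  \<open>norm x\<close>; the differences of the \<open>f (u k)\<close> must therefore be summable,
  uniformly over \<open>D\<close>.\<close>

definition sqvar :: "(nat \<Rightarrow> real) \<Rightarrow> (nat \<Rightarrow> nat) \<Rightarrow> nat \<Rightarrow> real" where
  "sqvar x p n = (\<Sum>j<n. (x (p (Suc j)) - x (p j))\<^sup>2)"

lemma sqvar_nonneg: "0 \<le> sqvar x p n"
  by (simp add: sqvar_def sum_nonneg)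

lemma james_sums_eq_sqvar: "james_sums x = {sqvar x p n |n p. strict_mono_on {..n} p}"
  by (simp add: james_sums_def sqvar_def)

lemma sqvar_cong: "(\<And>j. j \<le> n \<Longrightarrow> p j = q j) \<Longrightarrow> sqvar x p n = sqvar x q n"
  by (auto simp: sqvar_def intro!: sum.cong)

lemma sqvar_comp: "sqvar (x \<circ> \<phi>) p n = sqvar x (\<phi> \<circ> p) n"
  by (simp add: sqvar_def)

text \<open>A repeated index adds only a zero term and can be deleted. Repetitions arise when a
  strictly increasing path is composed with a monotone map such as
  \<open>\<lambda>j. max j n\<close>. The first index is tracked for
  \<open>sqvar_tail\<close>.\<close>

lemma sqvar_drop_repetitions:
  fixes q :: "nat \<Rightarrow> nat"
  assumes "mono_on {..n} q"
  obtains r m where "strict_mono_on {..m} r" "r 0 = q 0" "sqvar x r m = sqvar x q n"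
proof -
  \<comment> \<open>The last index is carried along as well, since the induction attaches the next
    index to it.\<close>
  have "\<exists>r m. strict_mono_on {..m} r \<and> r 0 = q 0 \<and> r m = q n \<and> sqvar x r m = sqvar x q n"
    using assms
  proof (induction n)
    case 0
    show ?case
      by (intro exI[of _ q] exI[of _ 0]) (auto simp: strict_mono_on_def)
  next
    case (Suc n)
    then have "mono_on {..n} q"
      by (auto simp: monotone_on_def)
    with Suc.IH obtain r m where r: "strict_mono_on {..m} r" "r 0 = q 0" "r m = q n"
        "sqvar x r m = sqvar x q n"
      by blast
    show ?case
    proof (cases "q (Suc n) = q n")
      case True
      then show ?thesis
        using r by (intro exI[of _ r] exI[of _ m]) (auto simp: sqvar_def)
    next
      case False
      with Suc.prems have less: "r m < q (Suc n)"
        using monotone_onD[OF Suc.prems, of n "Suc n"] r(3) by auto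
      have below: "r i \<le> r m" if "i \<le> m" for i
        using monotone_onD[OF strict_mono_on_imp_mono_on[OF r(1)], of i m] that by simp
      let ?r = "r(Suc m := q (Suc n))"
      have "strict_mono_on {..Suc m} ?r"
      proof (rule strict_mono_onI)
        fix i j assume "i \<in> {..Suc m}" "j \<in> {..Suc m}" "i < j"
        then show "?r i < ?r j"
          using below[of i] less strict_mono_onD[OF r(1), of i j] by (cases "j = Suc m") auto
      qed
      moreover have "sqvar x ?r (Suc m) = sqvar x q (Suc n)"
        using r(3,4) sqvar_cong[of m ?r r x] by (simp add: sqvar_def)
      moreover have "?r 0 = q 0" "?r (Suc m) = q (Suc n)"
        using r(2) by simp_all
      ultimately show ?thesis
        by blast
    qed
  qed
  then show thesis
    using that by blast
qed

lemma sqvar_append: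
  "sqvar x (\<lambda>j. if j \<le> n then p j else q (j - Suc n)) (Suc (n + m))
    = sqvar x p n + (x (q 0) - x (p n))\<^sup>2 + sqvar x q m"
proof (induction m)
  case 0
  show ?case
    by (simp add: sqvar_def)
next
  case (Suc m)
  then show ?case
    by (simp add: sqvar_def)
qed

text \<open>A path that nearly exhausts the supremum leaves little square variation behind its last index.\<close>

lemma sqvar_tail:
  assumes bound: "\<And>n p. strict_mono_on {..n} p \<Longrightarrow> sqvar x p n \<le> B" and "0 < e"
  obtains N where "\<And>n p. mono_on {..n} p \<Longrightarrow> N \<le> p 0 \<Longrightarrow> sqvar x p n \<le> e"
proof -
  have bdd: "bdd_above (james_sums x)"
    unfolding james_sums_eq_sqvar using bound by (intro bdd_aboveI[of _ B]) auto
  have ne: "james_sums x \<noteq> {}"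
    using zero_in_james_sums by auto
  obtain s where "s \<in> james_sums x" "Sup (james_sums x) - e < s"
    using less_cSupE[of "Sup (james_sums x) - e" "james_sums x"] ne \<open>0 < e\<close> by auto
  then obtain n p where p: "strict_mono_on {..n} p" "Sup (james_sums x) - e < sqvar x p n"
    by (auto simp: james_sums_eq_sqvar)
  have *: "sqvar x q m \<le> e" if q: "strict_mono_on {..m} q" "Suc (p n) \<le> q 0" for q m
  proof -
    let ?r = "\<lambda>j. if j \<le> n then p j else q (j - Suc n)"
    have "p i \<le> p n" if "i \<le> n" for i
      using monotone_onD[OF strict_mono_on_imp_mono_on[OF p(1)], of i n] that by simp
    moreover have "q 0 \<le> q i" if "i \<le> m" for i
      using strict_mono_onD[OF q(1), of 0 i] that by (cases "i = 0") auto
    ultimately have below: "p i < q j" if "i \<le> n" "j \<le> m" for i j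
      using q(2) that by (meson Suc_le_eq le_trans order_le_less_trans)
    have "strict_mono_on {..Suc (n + m)} ?r"
    proof (rule strict_mono_onI)
      fix i j assume "i \<in> {..Suc (n + m)}" "j \<in> {..Suc (n + m)}" "i < j"
      then show "?r i < ?r j"
        using strict_mono_onD[OF p(1), of i j] strict_mono_onD[OF q(1), of "i - Suc n" "j - Suc n"]
          below[of i "j - Suc n"] by auto
    qed
    then have "sqvar x ?r (Suc (n + m)) \<in> james_sums x"
      unfolding james_sums_eq_sqvar by blast
    \<comment> \<open>The joined path competes for the supremum, of which \<open>p\<close> alone
      leaves less than \<open>e\<close>; the jump between the two paths is dropped as a
      square.\<close>
    from cSup_upper[OF this bdd] show ?thesis
      using p(2) zero_le_power2[of "x (q 0) - x (p n)"] unfolding sqvar_append by linarith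
  qed
  show thesis
  proof (rule that)
    fix m and q :: "nat \<Rightarrow> nat" assume q: "mono_on {..m} q" "Suc (p n) \<le> q 0"
    obtain r k where "strict_mono_on {..k} r" "r 0 = q 0" "sqvar x r k = sqvar x q m"
      using sqvar_drop_repetitions[OF q(1)] .
    with * q(2) show "sqvar x q m \<le> e"
      by metis
  qed
qed

section \<open>The space \<open>J\<close> and its unit vector basis\<close>

lemma james_spaceI:
  assumes "x \<longlonglongrightarrow> 0" "\<And>n p. strict_mono_on {..n} p \<Longrightarrow> sqvar x p n \<le> B"
  shows "x \<in> james_space"
  using assms unfolding james_space_def james_sums_eq_sqvar by (auto intro!: bdd_aboveI[of _ B])

lemma sqvar_le_norm:
  assumes "mono_on {..n} p"
  shows "sqvar (james_apply X) p n \<le> (norm X)\<^sup>2"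
proof -
  obtain r m where r: "strict_mono_on {..m} r" "sqvar (james_apply X) r m = sqvar (james_apply X) p n"
    using sqvar_drop_repetitions[OF assms] by blast
  have bdd: "bdd_above (james_sums (james_apply X))"
    using james_apply[of X] by (simp add: james_space_def)
  have "0 \<le> Sup (james_sums (james_apply X))"
    by (rule cSup_upper[OF zero_in_james_sums bdd])
  moreover have "sqvar (james_apply X) r m \<le> Sup (james_sums (james_apply X))"
    by (rule cSup_upper[OF _ bdd]) (use r in \<open>auto simp: james_sums_eq_sqvar simp flip: r(2)\<close>)
  ultimately show ?thesis
    by (simp add: r norm_james.rep_eq james_norm_def)
qed

lemma norm_james_sqvar_le:
  assumes "\<And>n p. strict_mono_on {..n} p \<Longrightarrow> sqvar (james_apply X) p n \<le> B"
  shows "(norm X)\<^sup>2 \<le> B"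
proof -
  have "Sup (james_sums (james_apply X)) \<le> B"
  proof (rule cSup_least)
    show "james_sums (james_apply X) \<noteq> {}"
      using zero_in_james_sums by blast
  qed (use assms in \<open>auto simp: james_sums_eq_sqvar\<close>)
  moreover have "0 \<le> Sup (james_sums (james_apply X))"
    using james_apply[of X] by (intro cSup_upper zero_in_james_sums) (simp add: james_space_def)
  ultimately show ?thesis
    by (simp add: norm_james.rep_eq james_norm_def)
qed

lemma abs_james_apply_le: "\<bar>james_apply X i\<bar> \<le> norm X"
  by transfer (rule james_coord_le_norm)

lemma james_apply_tendsto_0: "james_apply X \<longlonglongrightarrow> 0"
  using james_apply[of X] by (simp add: james_space_def)

lemma james_eqI: "(\<And>j. james_apply X j = james_apply Y j) \<Longrightarrow> X = Y"
  using james_apply_inject by blast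

text \<open>Composition with \<open>\<phi>\<close> turns a path for \<open>Y\<close> into a monotone
  path for \<open>X\<close> with the same differences.\<close>

lemma norm_james_comp_le:
  assumes "mono \<phi>" "\<And>j. james_apply Y j = james_apply X (\<phi> j)"
  shows "norm Y \<le> norm X"
proof -
  have "(norm Y)\<^sup>2 \<le> (norm X)\<^sup>2"
  proof (rule norm_james_sqvar_le)
    fix n and p :: "nat \<Rightarrow> nat" assume "strict_mono_on {..n} p"
    then have "mono_on {..n} (\<phi> \<circ> p)"
      using \<open>mono \<phi>\<close> by (auto simp: monotone_on_def strict_mono_on_def le_less)
    moreover have "james_apply Y = james_apply X \<circ> \<phi>"
      using assms(2) by auto
    ultimately show "sqvar (james_apply Y) p n \<le> (norm X)\<^sup>2"
      by (simp add: sqvar_comp sqvar_le_norm)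
  qed
  then show ?thesis
    by simp
qed

text \<open>Once at \<open>a\<close>, a monotone path never falls below it again. The count bounds
  the nonzero differences of a step and the mixed terms of two successive supports.\<close>

lemma card_crossings_le_1:
  assumes "mono_on {..n} (p :: nat \<Rightarrow> nat)"
  shows "card {j. j < n \<and> p j < a \<and> a \<le> p (Suc j)} \<le> 1"
proof -
  have le: "j \<le> i" if "a \<le> p (Suc i)" "j < n" "p j < a" for i j
    using monotone_onD[OF assms, of "Suc i" j] that by force
  have "i = j" if "i < n" "p i < a" "a \<le> p (Suc i)" "j < n" "p j < a" "a \<le> p (Suc j)" for i j
    using le that by (blast intro: le_antisym)
  then have "card {j. j < n \<and> p j < a \<and> a \<le> p (Suc j)} \<le> Suc 0"
    by (subst card_le_Suc0_iff_eq) auto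
  then show ?thesis
    by simp
qed

lemma sqvar_of_bool_le_1:
  assumes "strict_mono_on {..m} p"
  shows "sqvar (\<lambda>j. of_bool (j < n)) p m \<le> 1"
proof -
  have "sqvar (\<lambda>j. of_bool (j < n)) p m \<le> (\<Sum>j<m. of_bool (p j < n \<and> n \<le> p (Suc j)))"
    unfolding sqvar_def
  proof (rule sum_mono)
    fix j assume "j \<in> {..<m}"
    then have "p j < p (Suc j)"
      by (intro strict_mono_onD[OF assms]) auto
    then show "(of_bool (p (Suc j) < n) - of_bool (p j < n))\<^sup>2 \<le> (of_bool (p j < n \<and> n \<le> p (Suc j)) :: real)"
      by auto
  qed
  also have "\<dots> = card {j. j < m \<and> p j < n \<and> n \<le> p (Suc j)}"
    by (simp add: of_bool_def sum.If_cases Collect_conj_eq lessThan_def)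
  also have "\<dots> \<le> 1"
    using card_crossings_le_1[OF strict_mono_on_imp_mono_on[OF assms]] by simp
  finally show ?thesis .
qed

section \<open>Steps, unit vectors and basis projections\<close>

lift_definition step :: "nat \<Rightarrow> james" is "\<lambda>n j. of_bool (j < n)"
proof (rule james_spaceI)
  fix n :: nat
  have "\<forall>\<^sub>F j in sequentially. of_bool (j < n) = (0 :: real)"
    using eventually_ge_at_top[of n] by eventually_elim auto
  then show "(\<lambda>j. of_bool (j < n) :: real) \<longlonglongrightarrow> 0"
    by (rule tendsto_eventually)
qed (rule sqvar_of_bool_le_1)

lemma norm_step_le_1: "norm (step n) \<le> 1"
proof -
  have "(norm (step n))\<^sup>2 \<le> 1"
    by (rule norm_james_sqvar_le) (simp add: step.rep_eq sqvar_of_bool_le_1)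
  then show ?thesis
    by (simp add: power_le_one_iff)
qed

lemma james_apply_sum: "james_apply (sum g S) j = (\<Sum>i\<in>S. james_apply (g i) j)"
  by (induction S rule: infinite_finite_induct) (simp_all add: zero_james.rep_eq plus_james.rep_eq)

lemmas james_apply_simps =
  zero_james.rep_eq plus_james.rep_eq minus_james.rep_eq uminus_james.rep_eq
  scaleR_james.rep_eq step.rep_eq james_apply_sum

lift_definition coord :: "nat \<Rightarrow> james \<Rightarrow>\<^sub>L real" is "\<lambda>k X. james_apply X k"
  by (rule bounded_linear_intro[where K = 1]) (simp_all add: james_apply_simps abs_james_apply_le)

text \<open>The unit vector at \<open>k\<close>, written so that partial sums telescope to
  steps.\<close>

definition unit :: "nat \<Rightarrow> james" where
  "unit k = step (Suc k) - step k"

lemma sum_unit: "(\<Sum>k<n. unit k) = step n"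
proof -
  have "step 0 = 0"
    by (rule james_eqI) (simp add: james_apply_simps)
  then show ?thesis
    unfolding unit_def by (simp add: sum_lessThan_telescope)
qed

text \<open>Truncation to the first \<open>n\<close> entries; as a finite sum of continuous maps it
  is continuous without any estimate.\<close>

lift_definition proj :: "nat \<Rightarrow> james \<Rightarrow>\<^sub>L james" is "\<lambda>n X. \<Sum>k<n. coord k X *\<^sub>R unit k"
  by (intro bounded_linear_sum bounded_linear_compose[OF bounded_linear_scaleR_left] blinfun.bounded_linear_right)

lemma james_apply_proj: "james_apply (proj n X) j = (if j < n then james_apply X j else 0)"
proof -
  have "james_apply (proj n X) j = (\<Sum>k<n. if j = k then james_apply X k else 0)"
    unfolding proj.rep_eq james_apply_sum
    by (intro sum.cong) (auto simp: unit_def james_apply_simps coord.rep_eq)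
  then show ?thesis
    by simp
qed

lemma proj_step: "m \<le> n \<Longrightarrow> proj m (step n) = step m"
  by (rule james_eqI) (auto simp: james_apply_proj step.rep_eq)

text \<open>Bare truncation creates a jump at \<open>n\<close>. Filling the gap below
  \<open>n\<close> with the value at \<open>n\<close> gives \<open>X\<close> frozen before
  \<open>n\<close>, a monotone reindexing that does not increase the norm; removing this plateau
  again costs only the size of that value.\<close>

lemma remainder_eq_comp:
  "james_apply (X - proj n X + james_apply X n *\<^sub>R step n) j = james_apply X (max j n)"
  by (auto simp: james_apply_simps james_apply_proj max_def)

lemma norm_remainder_le:
  "norm (X - proj n X) \<le> norm (X - proj n X + james_apply X n *\<^sub>R step n) + \<bar>james_apply X n\<bar>"
proof -
  have "norm (james_apply X n *\<^sub>R step n) \<le> \<bar>james_apply X n\<bar>"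
    using norm_step_le_1 by (simp add: mult_left_le)
  then show ?thesis
    using norm_triangle_ineq4[of "X - proj n X + james_apply X n *\<^sub>R step n" "james_apply X n *\<^sub>R step n"]
    by simp
qed

lemma norm_remainder_le_2: "norm (X - proj n X) \<le> 2 * norm X"
proof -
  have "norm (X - proj n X + james_apply X n *\<^sub>R step n) \<le> norm X"
    using remainder_eq_comp by (intro norm_james_comp_le[of "\<lambda>j. max j n"]) (auto simp: mono_def max_def)
  then show ?thesis
    using norm_remainder_le[of X n] abs_james_apply_le[of X n] by linarith
qed

lemma proj_tendsto: "(\<lambda>n. proj n X) \<longlonglongrightarrow> X"
proof (rule LIMSEQ_I)
  fix e :: real assume "0 < e"
  have "sqvar (james_apply X) p n \<le> (norm X)\<^sup>2" if "strict_mono_on {..n} p" for n p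
    using that by (intro sqvar_le_norm strict_mono_on_imp_mono_on)
  moreover have "0 < (e / 3)\<^sup>2"
    using \<open>0 < e\<close> by simp
  ultimately obtain N where N:
    "\<And>n p. mono_on {..n} p \<Longrightarrow> N \<le> p 0 \<Longrightarrow> sqvar (james_apply X) p n \<le> (e / 3)\<^sup>2"
    using sqvar_tail by metis
  obtain M where M: "\<And>j. j \<ge> M \<Longrightarrow> \<bar>james_apply X j\<bar> < e / 3"
    using LIMSEQ_D[OF james_apply_tendsto_0, of "e / 3" X] \<open>0 < e\<close> by auto
  have "norm (proj n X - X) < e" if n: "n \<ge> max M N" for n
  proof -
    let ?Z = "X - proj n X + james_apply X n *\<^sub>R step n"
    have "(norm ?Z)\<^sup>2 \<le> (e / 3)\<^sup>2"
    proof (rule norm_james_sqvar_le)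
      fix m and p :: "nat \<Rightarrow> nat" assume p: "strict_mono_on {..m} p"
      have "james_apply ?Z = james_apply X \<circ> (\<lambda>j. max j n)"
        using remainder_eq_comp by auto
      moreover have "mono_on {..m} ((\<lambda>j. max j n) \<circ> p)"
        using strict_mono_on_imp_mono_on[OF p] unfolding monotone_on_def o_def by (blast intro: max.mono order_refl)
      ultimately show "sqvar (james_apply ?Z) p m \<le> (e / 3)\<^sup>2"
        using N[of m "(\<lambda>j. max j n) \<circ> p"] n by (simp add: sqvar_comp le_max_iff_disj)
    qed
    then have "norm ?Z \<le> e / 3"
      by (rule power2_le_imp_le) (use \<open>0 < e\<close> in simp)
    moreover have "\<bar>james_apply X n\<bar> < e / 3"
      using M n by simp
    ultimately show ?thesis
      using norm_remainder_le[of X n] by (simp add: norm_minus_commute)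
  qed
  then show "\<exists>no. \<forall>n\<ge>no. norm (proj n X - X) < e"
    by blast
qed

section \<open>Disjoint blocks and the shrinking basis\<close>

text \<open>For successive supports only one difference, the one crossing \<open>a\<close>, yields a mixed term.\<close>

lemma norm_add_disjoint_le:
  assumes X: "\<And>j. a \<le> j \<Longrightarrow> james_apply X j = 0" and Y: "\<And>j. j < a \<Longrightarrow> james_apply Y j = 0"
    and B: "\<And>j. \<bar>james_apply X j\<bar> \<le> B" "\<And>j. \<bar>james_apply Y j\<bar> \<le> B"
  shows "(norm (X + Y))\<^sup>2 \<le> (norm X)\<^sup>2 + (norm Y)\<^sup>2 + 2 * B\<^sup>2"
proof (rule norm_james_sqvar_le)
  fix n and p :: "nat \<Rightarrow> nat" assume p: "strict_mono_on {..n} p"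
  let ?d = "\<lambda>Z j. james_apply Z (p (Suc j)) - james_apply Z (p j)"
  have "(\<Sum>j<n. ?d X j * ?d Y j) \<le> (\<Sum>j<n. B\<^sup>2 * of_bool (p j < a \<and> a \<le> p (Suc j)))"
  proof (rule sum_mono)
    fix j assume "j \<in> {..<n}"
    then have "p j < p (Suc j)"
      by (intro strict_mono_onD[OF p]) auto
    moreover have "- (james_apply X (p j) * james_apply Y (p (Suc j))) \<le> B\<^sup>2"
      using mult_mono[OF B(1)[of "p j"] B(2)[of "p (Suc j)"]] order_trans[OF abs_ge_zero B(1)]
      unfolding abs_mult[symmetric] by (simp add: power2_eq_square)
    ultimately show "?d X j * ?d Y j \<le> B\<^sup>2 * of_bool (p j < a \<and> a \<le> p (Suc j))"
      using X[of "p j"] X[of "p (Suc j)"] Y[of "p j"] Y[of "p (Suc j)"]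
      by (cases "p j < a"; cases "p (Suc j) < a") auto
  qed
  also have "\<dots> = B\<^sup>2 * card {j. j < n \<and> p j < a \<and> a \<le> p (Suc j)}"
    by (simp add: of_bool_def sum.If_cases Collect_conj_eq lessThan_def flip: sum_distrib_left)
  also have "\<dots> \<le> B\<^sup>2"
    using card_crossings_le_1[OF strict_mono_on_imp_mono_on[OF p], of a] by (simp add: mult_left_le)
  finally have mixed: "(\<Sum>j<n. ?d X j * ?d Y j) \<le> B\<^sup>2" .
  have "sqvar (james_apply (X + Y)) p n = (\<Sum>j<n. (?d X j)\<^sup>2 + (?d Y j)\<^sup>2 + 2 * (?d X j * ?d Y j))"
    unfolding sqvar_def by (intro sum.cong) (simp_all add: james_apply_simps power2_eq_square algebra_simps)
  also have "\<dots> = sqvar (james_apply X) p n + sqvar (james_apply Y) p n + 2 * (\<Sum>j<n. ?d X j * ?d Y j)"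
    by (simp add: sqvar_def sum.distrib sum_distrib_left)
  also have "\<dots> \<le> (norm X)\<^sup>2 + (norm Y)\<^sup>2 + 2 * B\<^sup>2"
    using mixed strict_mono_on_imp_mono_on[OF p] by (intro add_mono sqvar_le_norm) auto
  finally show "sqvar (james_apply (X + Y)) p n \<le> (norm X)\<^sup>2 + (norm Y)\<^sup>2 + 2 * B\<^sup>2" .
qed

text \<open>Sets the order \<open>sqrt n\<close> of the block estimates against linear growth, both
  in the proof that the basis is shrinking and in the choice of the length of an average.\<close>

lemma sqrt_less_linear:
  assumes "0 < (e :: real)"
  obtains n where "0 < n" "C * sqrt (real n) < e * real n"
proof -
  obtain n where n: "(C / e)\<^sup>2 < real n"
    using reals_Archimedean2 by blast
  then have "0 < n"
    by (cases "n = 0") auto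
  have "C / e < sqrt n"
    using n by (rule real_less_rsqrt)
  then have "C * sqrt n < (e * sqrt n) * sqrt n"
    using assms \<open>0 < n\<close> by (intro mult_strict_right_mono) (simp_all add: field_simps)
  then show thesis
    using that[of n] \<open>0 < n\<close> by (simp add: mult.assoc)
qed

text \<open>With suitable signs the left side is \<open>f\<close> of a single vector. By
  \<open>norm_add_disjoint_le\<close> each block adds at most
  \<open>B\<^sup>2 + 2 * B\<^sup>2\<close> to its squared norm, hence the 3.\<close>

lemma sum_abs_blocks_le:
  fixes f :: "james \<Rightarrow>\<^sub>L real"
  assumes "0 \<le> B" "\<And>i. norm (d i) \<le> B"
    and supp: "\<And>i j. james_apply (d i) j \<noteq> 0 \<Longrightarrow> a i \<le> j \<and> j < a (Suc i)" and "mono a"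
  shows "(\<Sum>i<n. \<bar>f (d i)\<bar>) \<le> norm f * (B * sqrt (3 * real n))"
proof -
  let ?d = "\<lambda>i. sgn (f (d i)) *\<^sub>R d i"
  define X where "X = (\<lambda>n. \<Sum>i<n. ?d i)"
  have sup_d: "\<bar>james_apply (?d i) j\<bar> \<le> B" for i j
    using order_trans[OF abs_james_apply_le assms(2), of i j] \<open>0 \<le> B\<close>
    by (simp add: james_apply_simps abs_mult abs_sgn_eq)
  have norm_d: "norm (?d i) \<le> B" for i
    using assms(2)[of i] \<open>0 \<le> B\<close> by (simp add: abs_sgn_eq)
  \<comment> \<open>The bound on the entries does not grow with \<open>n\<close>, as the supports
    are disjoint; this keeps the mixed terms bounded.\<close>
  have "(\<forall>j\<ge>a n. james_apply (X n) j = 0) \<and> (\<forall>j. \<bar>james_apply (X n) j\<bar> \<le> B)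
      \<and> (norm (X n))\<^sup>2 \<le> 3 * n * B\<^sup>2"
  proof (induction n)
    case 0
    show ?case
      using \<open>0 \<le> B\<close> by (simp add: X_def james_apply_simps)
  next
    case (Suc n)
    have X_Suc: "X (Suc n) = X n + ?d n"
      by (simp add: X_def)
    have zero: "james_apply (?d n) j = 0" if "j < a n \<or> a (Suc n) \<le> j" for j
      using supp[of n j] that by (auto simp: james_apply_simps)
    have "(norm (X n + ?d n))\<^sup>2 \<le> (norm (X n))\<^sup>2 + (norm (?d n))\<^sup>2 + 2 * B\<^sup>2"
      using Suc.IH zero sup_d by (intro norm_add_disjoint_le[of "a n"]) auto
    also have "\<dots> \<le> 3 * Suc n * B\<^sup>2"
      using Suc.IH power_mono[OF norm_d norm_ge_zero, of n 2] by (simp add: algebra_simps)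
    finally have "(norm (X (Suc n)))\<^sup>2 \<le> 3 * Suc n * B\<^sup>2"
      unfolding X_Suc .
    moreover have "\<bar>james_apply (X (Suc n)) j\<bar> \<le> B" for j
      using Suc.IH zero[of j] sup_d[of n j] unfolding X_Suc plus_james.rep_eq by (cases "j < a n") auto
    moreover have "james_apply (X (Suc n)) j = 0" if "j \<ge> a (Suc n)" for j
    proof -
      have "a n \<le> j"
        using monoD[OF \<open>mono a\<close>, of n "Suc n"] that by simp
      then show ?thesis
        using Suc.IH zero[of j] that unfolding X_Suc plus_james.rep_eq by auto
    qed
    ultimately show ?case
      by blast
  qed
  then have "norm (X n) \<le> sqrt (3 * real n * B\<^sup>2)"
    by (intro real_le_rsqrt) simp
  also have "\<dots> = B * sqrt (3 * real n)"
    using \<open>0 \<le> B\<close> by (simp add: real_sqrt_mult)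
  finally have "norm (X n) \<le> B * sqrt (3 * real n)" .
  moreover have "(\<Sum>i<n. \<bar>f (d i)\<bar>) = f (X n)"
    by (simp add: X_def blinfun.sum_right blinfun.scaleR_right abs_sgn mult.commute)
  moreover have "f (X n) \<le> norm f * norm (X n)"
    using norm_blinfun[of f "X n"] by simp
  ultimately show ?thesis
    using mult_left_mono[of "norm (X n)" "B * sqrt (3 * real n)" "norm f"] by simp
qed

text \<open>The basis of unit vectors is shrinking.\<close>

lemma compose_proj_tendsto:
  fixes f :: "james \<Rightarrow>\<^sub>L real"
  shows "(\<lambda>n. f o\<^sub>L proj n) \<longlonglongrightarrow> f"
proof (rule ccontr)
  assume "\<not> ?thesis"
  then obtain e where "0 < e" and e: "\<And>n. \<exists>m\<ge>n. norm ((f o\<^sub>L proj m) - f) \<ge> e"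
    unfolding LIMSEQ_iff by (auto simp: not_less)
  \<comment> \<open>Gliding hump: \<open>f\<close> is large on the remainder of some
    \<open>X\<close>, hence by continuity on a finite piece of it. A piece is a difference of two
    remainders of norm at most \<open>2 * norm X\<close>, hence the 4.\<close>
  have "\<exists>Y b. n \<le> b \<and> (\<forall>j. james_apply Y j \<noteq> 0 \<longrightarrow> n \<le> j \<and> j < b) \<and> norm Y \<le> 4 \<and> e / 2 < \<bar>f Y\<bar>" for n
  proof -
    obtain m where m: "n \<le> m" "norm ((f o\<^sub>L proj m) - f) \<ge> e"
      using e by blast
    have "\<not> (\<forall>X. norm (((f o\<^sub>L proj m) - f) X) \<le> e / 2 * norm X)"
      using m \<open>0 < e\<close> norm_blinfun_bound[of "e / 2" "(f o\<^sub>L proj m) - f"] by force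
    then obtain X where X: "e / 2 * norm X < \<bar>f (X - proj m X)\<bar>"
      by (auto simp: blinfun.diff_right blinfun.diff_left abs_minus_commute not_le)
    then have "X \<noteq> 0"
      by auto
    have "(\<lambda>k. \<bar>f (proj k X - proj m X)\<bar>) \<longlonglongrightarrow> \<bar>f (X - proj m X)\<bar>"
      by (intro tendsto_intros proj_tendsto)
    from order_tendstoD(1)[OF this X] obtain k where k: "m \<le> k" "e / 2 * norm X < \<bar>f (proj k X - proj m X)\<bar>"
      by (metis (no_types, lifting) eventually_sequentially le_cases)
    let ?Y = "(1 / norm X) *\<^sub>R (proj k X - proj m X)"
    have "norm (proj k X - proj m X) \<le> 4 * norm X"
      using norm_triangle_ineq4[of "X - proj m X" "X - proj k X"]
        norm_remainder_le_2[of X m] norm_remainder_le_2[of X k] by simp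
    then have "norm ?Y \<le> 4"
      using \<open>X \<noteq> 0\<close> by (simp add: divide_le_eq)
    moreover have "e / 2 < \<bar>f ?Y\<bar>"
      using k(2) \<open>X \<noteq> 0\<close> unfolding blinfun.scaleR_right by (simp add: abs_mult less_divide_eq)
    moreover have "n \<le> j \<and> j < k" if "james_apply ?Y j \<noteq> 0" for j
      using that m(1) k(1) by (auto simp: james_apply_simps james_apply_proj split: if_splits)
    ultimately show ?thesis
      using m(1) k(1) le_trans by blast
  qed
  then obtain Y b where Y: "\<And>n. n \<le> b n" "\<And>n j. james_apply (Y n) j \<noteq> 0 \<Longrightarrow> n \<le> j \<and> j < b n"
      "\<And>n. norm (Y n) \<le> 4" "\<And>n. e / 2 < \<bar>f (Y n)\<bar>"
    by metis
  \<comment> \<open>Iterating \<open>b\<close> puts the humps into consecutive blocks, where their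
    total of at least \<open>n * (e / 2)\<close> is too large for
    \<open>sum_abs_blocks_le\<close>.\<close>
  define a where "a = (\<lambda>i. (b ^^ i) 0)"
  have "mono a"
    using Y(1) by (intro mono_iff_le_Suc[THEN iffD2]) (simp add: a_def)
  have le: "real n * (e / 2) \<le> norm f * (4 * sqrt (3 * real n))" for n
  proof -
    have "real n * (e / 2) \<le> (\<Sum>i<n. \<bar>f (Y (a i))\<bar>)"
      using sum_mono[of "{..<n}" "\<lambda>_. e / 2" "\<lambda>i. \<bar>f (Y (a i))\<bar>"] Y(4) by (simp add: less_imp_le)
    also have "\<dots> \<le> norm f * (4 * sqrt (3 * real n))"
      using Y \<open>mono a\<close> by (intro sum_abs_blocks_le[of _ _ a]) (simp_all add: a_def)
    finally show ?thesis .
  qed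
  obtain n where "norm f * 4 * sqrt 3 * sqrt (real n) < e / 2 * real n"
    using sqrt_less_linear[of "e / 2" "norm f * 4 * sqrt 3"] \<open>0 < e\<close> by auto
  with le[of n] show False
    by (simp add: real_sqrt_mult mult_ac)
qed

section \<open>The bidual\<close>

text \<open>As the basis is shrinking, \<open>f\<close> is uniformly close on the unit ball to its
  composition with some \<open>proj m\<close>, which no longer distinguishes the steps from
  \<open>m\<close> on.\<close>

lemma convergent_apply_step:
  fixes f :: "james \<Rightarrow>\<^sub>L real"
  shows "convergent (\<lambda>n. f (step n))"
proof -
  have "Cauchy (\<lambda>n. f (step n))"
  proof (rule CauchyI')
    fix e :: real assume "0 < e"
    then obtain m where m: "norm ((f o\<^sub>L proj m) - f) < e / 2"
      using LIMSEQ_D[OF compose_proj_tendsto[of f], of "e / 2"] by auto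
    have *: "\<bar>f (step n) - f (step m)\<bar> < e / 2" if "n \<ge> m" for n
    proof -
      have "\<bar>f (step n) - f (step m)\<bar> = norm (((f o\<^sub>L proj m) - f) (step n))"
        using that by (simp add: proj_step blinfun.diff_left)
      also have "\<dots> \<le> norm ((f o\<^sub>L proj m) - f) * norm (step n)"
        by (rule norm_blinfun)
      also have "\<dots> \<le> norm ((f o\<^sub>L proj m) - f)"
        using norm_step_le_1 by (simp add: mult_left_le)
      finally show ?thesis
        using m by simp
    qed
    show "\<exists>M. \<forall>i\<ge>M. \<forall>n>i. dist (f (step i)) (f (step n)) < e"
    proof (intro exI allI impI)
      fix i n assume "m \<le> i" "i < n"
      then show "dist (f (step i)) (f (step n)) < e"
        using *[of i] *[of n] unfolding dist_real_def by (simp del: less_divide_eq_numeral1)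
    qed
  qed
  then show ?thesis
    by (simp add: Cauchy_convergent_iff)
qed

text \<open>The functional on \<open>J\<^sup>*\<close> given by the constant sequence 1, which lies in the bidual of \<open>J\<close> but not in \<open>J\<close>.\<close>

definition step_limit :: "(james \<Rightarrow>\<^sub>L real) \<Rightarrow>\<^sub>L real" where
  "step_limit = Blinfun (\<lambda>f :: james \<Rightarrow>\<^sub>L real. lim (\<lambda>n. f (step n)))"

lemma step_limit_tendsto:
  fixes f :: "james \<Rightarrow>\<^sub>L real"
  shows "(\<lambda>n. f (step n)) \<longlonglongrightarrow> step_limit f"
proof -
  note L = convergent_apply_step[unfolded convergent_LIMSEQ_iff]
  have "bounded_linear (\<lambda>f :: james \<Rightarrow>\<^sub>L real. lim (\<lambda>n. f (step n)))"
  proof (rule bounded_linear_intro[where K = 1])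
    fix f g :: "james \<Rightarrow>\<^sub>L real" and r :: real
    show "lim (\<lambda>n. (f + g) (step n)) = lim (\<lambda>n. f (step n)) + lim (\<lambda>n. g (step n))"
      unfolding blinfun.add_left by (intro limI tendsto_add L)
    show "lim (\<lambda>n. (r *\<^sub>R f) (step n)) = r *\<^sub>R lim (\<lambda>n. f (step n))"
      unfolding blinfun.scaleR_left by (intro limI tendsto_scaleR tendsto_const L)
    have "norm (f (step n)) \<le> norm f" for n
      using order_trans[OF norm_blinfun[of f "step n"] mult_left_le[OF norm_step_le_1[of n]]] by simp
    then show "norm (lim (\<lambda>n. f (step n))) \<le> norm f * 1"
      using LIMSEQ_le_const2[OF tendsto_norm[OF L]] by auto
  qed
  then show ?thesis
    using L by (simp add: step_limit_def bounded_linear_Blinfun_apply)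
qed

lemma proj_eq_sum: "proj n X = (\<Sum>k<n. james_apply X k *\<^sub>R unit k)"
  by (simp add: proj.rep_eq coord.rep_eq)

text \<open>Because the basis is shrinking, \<open>F\<close> is determined by its values
  \<open>z\<close> on the coordinate functionals. Their square variation is bounded by that of the
  norm, so \<open>z\<close> has a limit \<open>c\<close>, and \<open>z - c\<close> is an element of
  \<open>J\<close>.\<close>

lemma bidual_representation:
  fixes F :: "(james \<Rightarrow>\<^sub>L real) \<Rightarrow>\<^sub>L real"
  obtains Y c where "\<And>f. F f = f Y + c * step_limit f"
proof -
  define z where "z = (\<lambda>k. F (coord k))"
  have sqvar_z: "sqvar z p n \<le> (norm F)\<^sup>2" if p: "strict_mono_on {..n} p" for n p
  proof -
    let ?d = "\<lambda>j. z (p (Suc j)) - z (p j)"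
    \<comment> \<open>The equality case of Cauchy-Schwarz: \<open>F g\<close> is the square
      variation of \<open>z\<close>, while \<open>norm g\<close> is at most its square root.\<close>
    define g where "g = (\<Sum>j<n. ?d j *\<^sub>R (coord (p (Suc j)) - coord (p j)))"
    have "norm g \<le> sqrt (sqvar z p n)"
    proof (rule norm_blinfun_bound)
      fix X
      have "norm (g X) = \<bar>\<Sum>j<n. ?d j * (james_apply X (p (Suc j)) - james_apply X (p j))\<bar>"
        by (simp add: g_def blinfun.sum_left blinfun.scaleR_left blinfun.diff_left coord.rep_eq)
      also have "\<dots> \<le> L2_set ?d {..<n} * L2_set (\<lambda>j. james_apply X (p (Suc j)) - james_apply X (p j)) {..<n}"
        by (rule order_trans[OF sum_abs order_trans[OF _ L2_set_mult_ineq]]) (simp add: abs_mult)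
      also have "\<dots> \<le> sqrt (sqvar z p n) * norm X"
        using sqvar_le_norm[OF strict_mono_on_imp_mono_on[OF p], of X]
        by (intro mult_mono) (auto simp: L2_set_def sqvar_def sum_nonneg real_le_lsqrt)
      finally show "norm (g X) \<le> sqrt (sqvar z p n) * norm X" .
    qed (simp add: sqvar_nonneg)
    have "sqvar z p n = F g"
      by (simp add: g_def z_def sqvar_def blinfun.sum_right blinfun.scaleR_right blinfun.diff_right power2_eq_square)
    also have "\<dots> \<le> norm F * norm g"
      using norm_blinfun[of F g] by simp
    also have "\<dots> \<le> norm F * sqrt (sqvar z p n)"
      by (intro mult_left_mono \<open>norm g \<le> _\<close>) simp
    finally have "sqrt (sqvar z p n) * sqrt (sqvar z p n) \<le> norm F * sqrt (sqvar z p n)"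
      by (simp add: sqvar_nonneg)
    then have "sqrt (sqvar z p n) \<le> norm F"
      by (cases "sqvar z p n = 0") (use sqvar_nonneg[of z p n] in \<open>auto simp only: mult_le_cancel_right real_sqrt_gt_0_iff norm_ge_zero real_sqrt_zero\<close>)
    then show ?thesis
      using sqvar_nonneg by (simp add: sqrt_le_D)
  qed
  have "Cauchy z"
  proof (rule CauchyI')
    fix e :: real assume "0 < e"
    then obtain N where N: "\<And>n p. mono_on {..n} p \<Longrightarrow> N \<le> p 0 \<Longrightarrow> sqvar z p n \<le> (e / 2)\<^sup>2"
      using sqvar_tail[OF sqvar_z, of "(e / 2)\<^sup>2"] by (metis half_gt_zero zero_less_power)
    have "dist (z i) (z j) < e" if "N \<le> i" "i < j" for i j
    proof -
      have "mono_on {..1} (\<lambda>k :: nat. if k = 0 then i else j)"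
        using that by (auto simp: monotone_on_def)
      from N[OF this] have "(z j - z i)\<^sup>2 \<le> (e / 2)\<^sup>2"
        using that by (simp add: sqvar_def)
      then have "\<bar>z j - z i\<bar> \<le> \<bar>e / 2\<bar>"
        by (simp only: abs_le_square_iff)
      then show ?thesis
        using \<open>0 < e\<close> by (simp add: dist_real_def abs_minus_commute)
    qed
    then show "\<exists>M. \<forall>i\<ge>M. \<forall>j>i. dist (z i) (z j) < e"
      by blast
  qed
  then obtain c where c: "z \<longlonglongrightarrow> c"
    by (auto simp: Cauchy_convergent_iff convergent_def)
  have "(\<lambda>k. z k - c) \<in> james_space"
  proof (rule james_spaceI)
    show "(\<lambda>k. z k - c) \<longlonglongrightarrow> 0"
      using c by (simp add: LIM_zero_iff)
    show "sqvar (\<lambda>k. z k - c) p n \<le> (norm F)\<^sup>2" if "strict_mono_on {..n} p" for n p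
      using sqvar_z[OF that] by (simp add: sqvar_def)
  qed
  then obtain Y where Y: "\<And>k. james_apply Y k = z k - c"
    using James_inverse by metis
  have "F f = f Y + c * step_limit f" for f
  proof (rule LIMSEQ_unique)
    have "F (f o\<^sub>L proj n) = (\<Sum>k<n. f (unit k) * z k)" for n
    proof -
      have "f o\<^sub>L proj n = (\<Sum>k<n. f (unit k) *\<^sub>R coord k)"
        by (rule blinfun_eqI)
          (simp add: proj_eq_sum coord.rep_eq blinfun.sum_left blinfun.scaleR_left blinfun.sum_right
            blinfun.scaleR_right mult.commute)
      then show ?thesis
        by (simp add: z_def blinfun.sum_right blinfun.scaleR_right)
    qed
    \<comment> \<open>Here \<open>z k\<close> splits into the entry of \<open>Y\<close> and the
      constant \<open>c\<close>; the constant part sums the unit vectors to a step.\<close>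
    also have "(\<Sum>k<n. f (unit k) * z k) = f (proj n Y) + c * f (step n)" for n
      by (simp add: proj_eq_sum Y blinfun.sum_right blinfun.scaleR_right blinfun.diff_right sum_unit[symmetric]
          sum_distrib_left sum.distrib[symmetric] algebra_simps)
    finally show "(\<lambda>n. F (f o\<^sub>L proj n)) \<longlonglongrightarrow> f Y + c * step_limit f"
      by (simp only:) (intro tendsto_intros proj_tendsto step_limit_tendsto)
    show "(\<lambda>n. F (f o\<^sub>L proj n)) \<longlonglongrightarrow> F f"
      by (intro blinfun.tendsto tendsto_const compose_proj_tendsto)
  qed
  then show thesis
    by (rule that)
qed

section \<open>The interpolation operators\<close>

text \<open>
  For sharp steps the sum is \<open>X\<close>, truncated and slowed down by a monotone reindexing, minus its
  initial plateau.
\<close>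

lemma norm_step_interpolation_le:
  assumes "strict_mono m"
  shows "norm (\<Sum>k<K. james_apply X k *\<^sub>R (step (m (Suc k)) - step (m k))) \<le> 4 * norm X"
proof (cases "K = 0")
  case False
  \<comment> \<open>The first step that covers position \<open>j\<close>; the k-th increment is 1 at
    \<open>j\<close> exactly when \<open>c j = Suc k\<close>.\<close>
  define c where "c = (\<lambda>j. LEAST k. j < m k)"
  have c: "j < m k \<longleftrightarrow> c j \<le> k" for j k
  proof
    show "j < m k \<Longrightarrow> c j \<le> k"
      unfolding c_def by (rule Least_le)
    have "j < m (Suc j)"
      using strict_mono_imp_increasing[OF assms, of "Suc j"] by simp
    then have "j < m (c j)"
      unfolding c_def by (rule LeastI)
    then show "c j \<le> k \<Longrightarrow> j < m k"
      using strict_mono_leD[OF assms, of "c j" k] by simp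
  qed
  let ?S = "\<Sum>k<K. james_apply X k *\<^sub>R (step (m (Suc k)) - step (m k))"
  \<comment> \<open>With the plateau restored, \<open>c j = 0\<close> and \<open>c j = 1\<close>
    both read entry 0, as the truncated subtraction in \<open>c j - 1\<close> prescribes.\<close>
  let ?Y = "?S + james_apply X 0 *\<^sub>R step (m 0)"
  have "norm ?Y \<le> norm (proj K X)"
  proof (rule norm_james_comp_le)
    have "c i \<le> c j" if "i \<le> j" for i j
      using c[of j "c j"] c[of i "c j"] that by simp
    then show "mono (\<lambda>j. c j - 1)"
      by (auto simp: mono_def intro: diff_le_mono)
    fix j
    have "james_apply ?S j = (\<Sum>k<K. if k = c j - 1 then of_bool (c j \<noteq> 0) * james_apply X k else 0)"
      unfolding james_apply_sum by (intro sum.cong) (auto simp: james_apply_simps c)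
    then show "james_apply ?Y j = james_apply (proj K X) (c j - 1)"
      using False by (auto simp: james_apply_simps james_apply_proj c)
  qed
  \<comment> \<open>Truncation costs the factor 3, and removing the plateau below costs one more
    norm.\<close>
  also have "\<dots> \<le> 3 * norm X"
    using norm_remainder_le_2[of X K] norm_triangle_ineq4[of X "X - proj K X"] by simp
  finally have "norm ?Y \<le> 3 * norm X" .
  moreover have "norm (james_apply X 0 *\<^sub>R step (m 0)) \<le> norm X"
    using mult_mono[OF abs_james_apply_le[of X 0] norm_step_le_1[of "m 0"]] by simp
  ultimately show ?thesis
    using norm_triangle_ineq4[of ?Y "james_apply X 0 *\<^sub>R step (m 0)"] by simp
qed simp

text \<open>The sum is affine in each \<open>u k\<close> separately, so the bound passes to convex combinations one index at a time.\<close>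

lemma norm_interpolation_le:
  assumes "strict_mono a" and u: "\<And>k. u k \<in> convex hull (step ` {a k..<a (Suc k)})"
  shows "norm (\<Sum>k<K. james_apply X k *\<^sub>R (u (Suc k) - u k)) \<le> 4 * norm X"
proof -
  define G :: "(nat \<Rightarrow> james) \<Rightarrow> james" where "G = (\<lambda>w. \<Sum>k<K. james_apply X k *\<^sub>R (w (Suc k) - w k))"
  have G_affine: "G (w(i := s *\<^sub>R v + t *\<^sub>R v')) = s *\<^sub>R G (w(i := v)) + t *\<^sub>R G (w(i := v'))"
    if "s + t = 1" for w i s t v v'
  proof -
    have "w k = s *\<^sub>R w k + t *\<^sub>R w k" for k
      using that scaleR_add_left[of s t "w k"] by simp
    then have "(w(i := s *\<^sub>R v + t *\<^sub>R v')) k = s *\<^sub>R (w(i := v)) k + t *\<^sub>R (w(i := v')) k" for k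
      by simp
    then show ?thesis
      unfolding G_def by (simp only: scaleR_sum_right sum.distrib[symmetric])
        (intro sum.cong refl, simp only: scaleR_right_diff_distrib scaleR_add_right scaleR_left_commute[of _ "james_apply X _"] add_diff_add)
  qed
  \<comment> \<open>Mixed sequences are needed for the induction: given averages below
    \<open>i\<close>, arbitrary sharp steps from the proper blocks elsewhere.\<close>
  have "norm (G w) \<le> 4 * norm X"
    if "\<And>k. w k \<in> (if k < i then {u k} else step ` {a k..<a (Suc k)})" for w i
    using that
  proof (induction i arbitrary: w)
    case 0
    then have "\<forall>k. \<exists>n. a k \<le> n \<and> n < a (Suc k) \<and> w k = step n"
      by fastforce
    then obtain m where m: "\<And>k. a k \<le> m k" "\<And>k. m k < a (Suc k)" "\<And>k. w k = step (m k)"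
      by metis
    have "strict_mono m"
      unfolding strict_mono_Suc_iff using m(1,2) less_le_trans by blast
    then show ?case
      unfolding G_def m(3) by (rule norm_step_interpolation_le)
  next
    case (Suc i)
    \<comment> \<open>A sublevel set in the i-th argument alone. It is convex and contains the steps
      of the block, hence also their hull.\<close>
    define S where "S = {v. norm (G (w(i := v))) \<le> 4 * norm X}"
    have "step ` {a i..<a (Suc i)} \<subseteq> S"
    proof
      fix v assume v: "v \<in> step ` {a i..<a (Suc i)}"
      have "(w(i := v)) k \<in> (if k < i then {u k} else step ` {a k..<a (Suc k)})" for k
        using Suc.prems[of k] v by (cases "k = i") (simp_all add: less_Suc_eq)
      then show "v \<in> S"
        unfolding S_def by (intro CollectI Suc.IH)
    qed
    moreover have "convex S"
    proof (rule convexI)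
      fix v v' and s t :: real assume *: "v \<in> S" "v' \<in> S" "0 \<le> s" "0 \<le> t" "s + t = 1"
      have "norm (s *\<^sub>R G (w(i := v)) + t *\<^sub>R G (w(i := v'))) \<le> s * (4 * norm X) + t * (4 * norm X)"
        using * by (intro norm_triangle_le add_mono) (simp_all add: S_def mult_left_mono)
      then show "s *\<^sub>R v + t *\<^sub>R v' \<in> S"
        using * by (simp add: S_def G_affine flip: distrib_right)
    qed
    ultimately have "u i \<in> S"
      using u[of i] hull_minimal by blast
    moreover have "w(i := u i) = w"
      using Suc.prems[of i] by (simp add: fun_upd_idem)
    ultimately show ?case
      by (simp add: S_def)
  qed
  \<comment> \<open>The sum sees only the entries up to \<open>K\<close>; the steps beyond are
    fillers.\<close>
  from this[of "\<lambda>k. if k < Suc K then u k else step (a k)" "Suc K"]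
  have "norm (G (\<lambda>k. if k < Suc K then u k else step (a k))) \<le> 4 * norm X"
    using strict_monoD[OF \<open>strict_mono a\<close>] by auto
  also have "G (\<lambda>k. if k < Suc K then u k else step (a k)) = G u"
    unfolding G_def by (intro sum.cong) auto
  finally show ?thesis
    by (simp add: G_def)
qed

text \<open>On truncated sequences the partial sums are eventually constant; the uniform bound 4
  carries convergence over to their limits.\<close>

lemma interpolation_operator:
  assumes "strict_mono a" and u: "\<And>k. u k \<in> convex hull (step ` {a k..<a (Suc k)})"
  obtains T :: "james \<Rightarrow>\<^sub>L james" where "norm T \<le> 4"
    and "\<And>X. (\<lambda>K. \<Sum>k<K. james_apply X k *\<^sub>R (u (Suc k) - u k)) \<longlonglongrightarrow> T X"
proof -
  define S where "S = (\<lambda>K X. \<Sum>k<K. james_apply X k *\<^sub>R (u (Suc k) - u k))"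
  have norm_S: "norm (S K X) \<le> 4 * norm X" for K X
    unfolding S_def using assms by (rule norm_interpolation_le)
  have S_add: "S K (X + Y) = S K X + S K Y" and S_scale: "S K (r *\<^sub>R X) = r *\<^sub>R S K X" for K X Y r
    by (simp_all add: S_def james_apply_simps scaleR_add_left sum.distrib scaleR_sum_right)
  have S_diff: "S K (X - Y) = S K X - S K Y" for K X Y
    by (simp add: S_def james_apply_simps scaleR_left_diff_distrib sum_subtractf)
  have "Cauchy (\<lambda>K. S K X)" for X
  proof (rule CauchyI)
    fix e :: real assume "0 < e"
    then obtain N where N: "norm (proj N X - X) < e / 8"
      using LIMSEQ_D[OF proj_tendsto[of X], of "e / 8"] by auto
    have near: "norm (S K X - S N X) < e / 2" if "K \<ge> N" for K
    proof -
      have "S K (proj N X) = S N (proj N X)"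
        unfolding S_def using that by (intro sum.mono_neutral_right) (auto simp: james_apply_proj)
      also have "\<dots> = S N X"
        unfolding S_def by (intro sum.cong) (auto simp: james_apply_proj)
      finally have "S K X - S N X = S K (X - proj N X)"
        by (simp add: S_diff)
      then show ?thesis
        using norm_S[of K "X - proj N X"] N by (simp add: norm_minus_commute)
    qed
    have "norm (S i X - S j X) < e" if "i \<ge> N" "j \<ge> N" for i j
      using near[OF that(1)] near[OF that(2)] norm_triangle_ineq4[of "S i X - S N X" "S j X - S N X"] by simp
    then show "\<exists>M. \<forall>i\<ge>M. \<forall>j\<ge>M. norm (S i X - S j X) < e"
      by blast
  qed
  then have lim: "(\<lambda>K. S K X) \<longlonglongrightarrow> lim (\<lambda>K. S K X)" for X
    by (simp add: Cauchy_convergent_iff convergent_LIMSEQ_iff)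
  define T where "T = Blinfun (\<lambda>X. lim (\<lambda>K. S K X))"
  have norm_lim: "norm (lim (\<lambda>K. S K X)) \<le> 4 * norm X" for X
    using LIMSEQ_le_const2[OF tendsto_norm[OF lim]] norm_S by blast
  have "bounded_linear (\<lambda>X. lim (\<lambda>K. S K X))"
  proof (rule bounded_linear_intro[where K = 4])
    show "lim (\<lambda>K. S K (X + Y)) = lim (\<lambda>K. S K X) + lim (\<lambda>K. S K Y)" for X Y
      unfolding S_add by (intro limI tendsto_add lim)
    show "lim (\<lambda>K. S K (r *\<^sub>R X)) = r *\<^sub>R lim (\<lambda>K. S K X)" for r X
      unfolding S_scale by (intro limI tendsto_scaleR tendsto_const lim)
  qed (use norm_lim in \<open>simp add: mult.commute\<close>)
  then have T: "T X = lim (\<lambda>K. S K X)" for X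
    by (simp add: T_def bounded_linear_Blinfun_apply)
  show thesis
  proof (rule that)
    show "norm T \<le> 4"
      by (rule norm_blinfun_bound) (simp_all add: T norm_lim)
    show "(\<lambda>K. \<Sum>k<K. james_apply X k *\<^sub>R (u (Suc k) - u k)) \<longlonglongrightarrow> T X" for X
      using lim[of X] unfolding T S_def .
  qed
qed

text \<open>The k-th block begins at \<open>k\<close> or later, so eventually all its steps lie in
  the preimage of a ball around the limit, which is convex.\<close>

lemma apply_convex_steps_tendsto:
  fixes f :: "james \<Rightarrow>\<^sub>L real"
  assumes "strict_mono a" and u: "\<And>k. u k \<in> convex hull (step ` {a k..<a (Suc k)})"
  shows "(\<lambda>k. f (u k)) \<longlonglongrightarrow> step_limit f"
proof (rule LIMSEQ_I)
  fix e :: real assume "0 < e"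
  then obtain N where N: "\<And>n. n \<ge> N \<Longrightarrow> \<bar>f (step n) - step_limit f\<bar> < e"
    using LIMSEQ_D[OF step_limit_tendsto[of f], of e] by auto
  have "u k \<in> blinfun_apply f -` ball (step_limit f) e" if "k \<ge> N" for k
  proof -
    have "step ` {a k..<a (Suc k)} \<subseteq> blinfun_apply f -` ball (step_limit f) e"
      using N strict_mono_imp_increasing[OF \<open>strict_mono a\<close>, of k] that
      by (auto simp: dist_real_def abs_minus_commute)
    moreover have "convex (blinfun_apply f -` ball (step_limit f) e)"
      by (intro convex_linear_vimage convex_ball bounded_linear.linear blinfun.bounded_linear_right)
    ultimately show ?thesis
      using u[of k] hull_minimal by blast
  qed
  then show "\<exists>no. \<forall>n\<ge>no. norm (f (u n) - step_limit f) < e"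
    by (intro exI[of _ N]) (simp add: dist_real_def abs_minus_commute)
qed

text \<open>
  \<open>T\<close> fixes the constant sequence modulo \<open>J\<close>, so the bidual of \<open>id - T\<close> maps into \<open>J\<close>.
\<close>

lemma bidual_interpolation_remainder:
  fixes F :: "(james \<Rightarrow>\<^sub>L real) \<Rightarrow>\<^sub>L real" and T :: "james \<Rightarrow>\<^sub>L james"
  assumes "strict_mono a" and u: "\<And>k. u k \<in> convex hull (step ` {a k..<a (Suc k)})"
    and T: "\<And>X. (\<lambda>K. \<Sum>k<K. james_apply X k *\<^sub>R (u (Suc k) - u k)) \<longlonglongrightarrow> T X"
  obtains Y where "\<And>f. F (f - (f o\<^sub>L T)) = f Y"
proof -
  obtain Y c where F: "\<And>f. F f = f Y + c * step_limit f"
    using bidual_representation[of F] by blast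
  \<comment> \<open>By telescoping, \<open>T\<close> shifts the averages by \<open>u 0\<close> only,
    and these have the same limit as the steps under every functional.\<close>
  have T_step: "T (step n) = u n - u 0" for n
  proof (rule LIMSEQ_unique[OF T])
    have "(\<Sum>k<K. james_apply (step n) k *\<^sub>R (u (Suc k) - u k)) = u n - u 0" if "K \<ge> n" for K
    proof -
      have "(\<Sum>k<K. james_apply (step n) k *\<^sub>R (u (Suc k) - u k)) = (\<Sum>k<n. u (Suc k) - u k)"
        using that by (intro sum.mono_neutral_cong_right) (auto simp: james_apply_simps)
      then show ?thesis
        by (simp add: sum_lessThan_telescope)
    qed
    then show "(\<lambda>K. \<Sum>k<K. james_apply (step n) k *\<^sub>R (u (Suc k) - u k)) \<longlonglongrightarrow> u n - u 0"
      by (intro tendsto_eventually eventually_sequentiallyI[of n])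
  qed
  have L: "step_limit (f o\<^sub>L T) = step_limit f - f (u 0)" for f :: "james \<Rightarrow>\<^sub>L real"
  proof (rule LIMSEQ_unique[OF step_limit_tendsto])
    show "(\<lambda>n. (f o\<^sub>L T) (step n)) \<longlonglongrightarrow> step_limit f - f (u 0)"
      unfolding blinfun_apply_blinfun_compose T_step blinfun.diff_right
      using assms(1,2) by (intro tendsto_diff tendsto_const apply_convex_steps_tendsto)
  qed
  \<comment> \<open>The two multiples of \<open>step_limit f\<close> cancel, leaving the offset
    \<open>c *\<^sub>R u 0\<close>, an element of \<open>J\<close>.\<close>
  then have "F (f - (f o\<^sub>L T)) = f (Y - T Y + c *\<^sub>R u 0)" for f
    by (simp only: blinfun.diff_right F L blinfun.add_right
        blinfun.scaleR_right) (simp add: right_diff_distrib)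
  then show thesis
    by (rule that)
qed

section \<open>Weakly compact sets in the dual\<close>

text \<open>By Baire some \<open>E n\<close> contains a ball of radius \<open>r\<close>; differences
  of its points give the constant \<open>2 * n / r\<close>.\<close>

lemma uniform_boundedness:
  fixes D :: "('a::banach \<Rightarrow>\<^sub>L 'b::real_normed_vector) set"
  assumes "\<And>x. \<exists>c. \<forall>f\<in>D. norm (f x) \<le> c"
  obtains B where "0 \<le> B" "\<And>f. f \<in> D \<Longrightarrow> norm f \<le> B"
proof -
  define E where "E = (\<lambda>n. {x. \<forall>f\<in>D. norm (f x) \<le> real n})"
  have "closed (E n)" for n
  proof -
    have "E n = (\<Inter>f\<in>D. {x. norm (blinfun_apply f x) \<le> real n})"
      by (auto simp: E_def)
    then show ?thesis
      by (auto intro!: closed_INT closed_Collect_le continuous_intros)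
  qed
  moreover have "\<Union>(range E) = UNIV"
  proof -
    have "\<exists>n. x \<in> E n" for x
    proof -
      obtain c where "\<forall>f\<in>D. norm (f x) \<le> c"
        using assms by blast
      then have "x \<in> E (nat \<lceil>c\<rceil>)"
        unfolding E_def by (auto intro: order_trans[OF _ real_nat_ceiling_ge])
      then show ?thesis
        by blast
    qed
    then show ?thesis
      by blast
  qed
  moreover have "Met_TC.mcomplete TYPE('a)"
    by (simp add: mcomplete_iff_complete complete_UNIV)
  ultimately have "\<not> (\<forall>n. interior (E n) = {})"
    using Met_TC.metric_Baire_category_alt[of "range E"] by auto
  then obtain n where "interior (E n) \<noteq> {}"
    by blast
  then obtain x0 r where r: "0 < r" "cball x0 r \<subseteq> E n"
    by (metis ex_in_conv mem_interior_cball)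
  have "norm f \<le> 2 * real n / r" if "f \<in> D" for f
  proof (rule norm_blinfun_bound)
    fix x
    show "norm (f x) \<le> 2 * real n / r * norm x"
    proof (cases "x = 0")
      case False
      let ?y = "(r / norm x) *\<^sub>R x"
      have "x0 + ?y \<in> E n" "x0 \<in> E n"
        using r False by (auto intro!: subsetD[OF r(2)] simp: dist_norm)
      then have "norm (f (x0 + ?y)) \<le> n" "norm (f x0) \<le> n"
        using that by (auto simp: E_def)
      then have "norm (f (x0 + ?y) - f x0) \<le> n + n"
        using norm_triangle_ineq4[of "f (x0 + ?y)" "f x0"] by linarith
      then show ?thesis
        using r(1) False by (simp add: blinfun.add_right blinfun.scaleR_right field_simps)
    qed simp
  qed (use r in simp)
  then show thesis
    using that[of "2 * real n / r"] r by simp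
qed

section \<open>The weak topology and point evaluations\<close>

lemma topspace_weak_topology [simp]: "topspace weak_topology = UNIV"
  unfolding weak_topology_def topology_generated_by_topspace by (auto intro!: exI[of _ UNIV])

lemma openin_weak_topology:
  fixes f :: "'a::real_normed_vector \<Rightarrow>\<^sub>L real"
  shows "open U \<Longrightarrow> openin weak_topology (blinfun_apply f -` U)"
  unfolding weak_topology_def by (intro topology_generated_by_Basis) blast

lemma continuous_map_weak_topology:
  fixes f :: "'a::real_normed_vector \<Rightarrow>\<^sub>L real"
  shows "continuous_map weak_topology euclidean (blinfun_apply f)"
  by (simp add: continuous_map_alt openin_weak_topology flip: open_openin)

text \<open>The canonical image of \<open>x\<close> in the bidual, through which point evaluations
  are weakly continuous.\<close>

lemma evaluation_functional:
  obtains E :: "('a::real_normed_vector \<Rightarrow>\<^sub>L real) \<Rightarrow>\<^sub>L real" where "\<And>f. E f = f x"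
  using bounded_linear_Blinfun_apply[OF blinfun.bounded_linear_left[of x]] by metis

lemma weakly_compact_imp_norm_bounded:
  fixes D :: "('a::banach \<Rightarrow>\<^sub>L real) set"
  assumes "weakly_compact D"
  obtains B where "0 \<le> B" "\<And>f. f \<in> D \<Longrightarrow> norm f \<le> B"
proof (rule uniform_boundedness)
  fix x :: 'a
  obtain E :: "('a \<Rightarrow>\<^sub>L real) \<Rightarrow>\<^sub>L real" where E: "\<And>f. E f = f x"
    using evaluation_functional by blast
  have "compactin euclidean (E ` D)"
    using assms continuous_map_weak_topology unfolding weakly_compact_def by (rule image_compactin)
  then have "bounded (E ` D)"
    by (simp add: compact_imp_bounded)
  then show "\<exists>c. \<forall>f\<in>D. norm (f x) \<le> c"
    by (auto simp: bounded_iff E)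
qed (rule that)

section \<open>Averages of steps near the limit\<close>

text \<open>Every \<open>f\<close> satisfies the estimate at all late indices, and for a fixed index
  it is a weakly open condition, as \<open>step_limit\<close> lies in the bidual. A finite subcover
  bounds the indices required, but the index still depends on \<open>f\<close>.\<close>

lemma weakly_compact_step_near_limit:
  fixes D :: "(james \<Rightarrow>\<^sub>L real) set"
  assumes "weakly_compact D" "0 < e"
  obtains m where "n < m" "\<And>f :: james \<Rightarrow>\<^sub>L real. f \<in> D \<Longrightarrow> \<exists>t\<in>{n..<m}. \<bar>blinfun_apply f (step t) - step_limit f\<bar> < e"
proof -
  define U where "U = (\<lambda>t. {f :: james \<Rightarrow>\<^sub>L real. \<bar>blinfun_apply f (step t) - step_limit f\<bar> < e})"
  have "openin weak_topology (U t)" for t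
  proof -
    obtain E :: "(james \<Rightarrow>\<^sub>L real) \<Rightarrow>\<^sub>L real" where E: "\<And>f. E f = f (step t)"
      using evaluation_functional by blast
    have "U t = blinfun_apply (E - step_limit) -` {-e<..<e}"
      by (auto simp: U_def E blinfun.diff_left abs_less_iff)
    then show ?thesis
      by (simp add: openin_weak_topology)
  qed
  moreover have "\<exists>t\<ge>n. f \<in> U t" for f :: "james \<Rightarrow>\<^sub>L real"
  proof -
    obtain N where "\<forall>k\<ge>N. norm (f (step k) - step_limit f) < e"
      using LIMSEQ_D[OF step_limit_tendsto \<open>0 < e\<close>, of f] by blast
    then show ?thesis
      by (intro exI[of _ "max n N"]) (simp add: U_def)
  qed
  then have "D \<subseteq> \<Union>(U ` {n..})"
    by blast
  ultimately obtain \<F> where \<F>: "finite \<F>" "\<F> \<subseteq> U ` {n..}" "D \<subseteq> \<Union>\<F>"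
    using assms(1)[unfolded weakly_compact_def compactin_def, THEN conjunct2, rule_format, of "U ` {n..}"]
    by blast
  then obtain I where I: "finite I" "I \<subseteq> {n..}" "\<F> = U ` I"
    using finite_subset_image by metis
  obtain m where m: "\<forall>t\<in>insert n I. t < m"
    using I(1) finite_nat_set_iff_bounded by (metis finite_insert)
  show thesis
  proof (rule that)
    show "n < m"
      using m by simp
    fix f assume "f \<in> D"
    then obtain t where "t \<in> I" "f \<in> U t"
      using \<F>(3) I(3) by blast
    then show "\<exists>t\<in>{n..<m}. \<bar>blinfun_apply f (step t) - step_limit f\<bar> < e"
      using I(2) m by (intro bexI[of _ t]) (auto simp: U_def)
  qed
qed

text \<open>
  Each \<open>f \<in> D\<close> comes close to its limit between any two of the chosen indices, so the errors at
  these indices are controlled by \<open>f\<close> on disjoint blocks, and the average of \<open>n\<close> of them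
  by \<open>1 / sqrt n\<close>.
\<close>

lemma weakly_compact_average_near_limit:
  fixes D :: "(james \<Rightarrow>\<^sub>L real) set"
  assumes "weakly_compact D" "0 < e"
  obtains b v where "N < b" "v \<in> convex hull (step ` {N..<b})"
    "\<And>f :: james \<Rightarrow>\<^sub>L real. f \<in> D \<Longrightarrow> \<bar>blinfun_apply f v - step_limit f\<bar> \<le> e"
proof -
  obtain B where B: "0 \<le> B" "\<And>f. f \<in> D \<Longrightarrow> norm f \<le> B"
    using weakly_compact_imp_norm_bounded[OF assms(1)] by blast
  have "\<forall>n. \<exists>m. n < m \<and> (\<forall>f\<in>D. \<exists>t\<in>{n..<m}. \<bar>blinfun_apply f (step t) - step_limit f\<bar> < e / 2)"
    using weakly_compact_step_near_limit[OF assms(1), of "e / 2"] assms(2) by (metis half_gt_zero)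
  then obtain s where s: "\<And>n. n < s n"
    "\<And>n (f :: james \<Rightarrow>\<^sub>L real). f \<in> D \<Longrightarrow> \<exists>t\<in>{n..<s n}. \<bar>blinfun_apply f (step t) - step_limit f\<bar> < e / 2"
    by metis
  define a where "a = (\<lambda>i. (s ^^ i) N)"
  have "strict_mono a"
    unfolding strict_mono_Suc_iff using s(1) by (simp add: a_def)
  then have "mono a"
    by (rule strict_mono_mono)
  \<comment> \<open>The factor 2 bounds the difference of two steps, and \<open>sqrt 3\<close> comes
    from \<open>sum_abs_blocks_le\<close>.\<close>
  obtain n where n: "0 < n" "B * (2 * sqrt 3) * sqrt (real n) < e / 2 * real n"
    using sqrt_less_linear[of "e / 2"] assms(2) by (metis half_gt_zero)
  define v where "v = (\<Sum>i<n. (1 / real n) *\<^sub>R step (a i))"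
  show thesis
  proof (rule that)
    show "N < a n"
      using strict_monoD[OF \<open>strict_mono a\<close> n(1)] by (simp add: a_def)
    show "v \<in> convex hull (step ` {N..<a n})"
      unfolding v_def
    proof (intro convex_sum convex_convex_hull hull_inc imageI)
      fix i assume "i \<in> {..<n}"
      then show "a i \<in> {N..<a n}"
        using monoD[OF \<open>mono a\<close>, of 0 i] strict_monoD[OF \<open>strict_mono a\<close>, of i n] by (simp add: a_def)
    qed (use n in auto)
    fix f assume f: "f \<in> D"
    have "\<forall>i. \<exists>t. a i \<le> t \<and> t < a (Suc i) \<and> \<bar>blinfun_apply f (step t) - step_limit f\<bar> < e / 2"
      using s(2)[OF f] by (fastforce simp: a_def)
    \<comment> \<open>The indices \<open>t i\<close> depend on \<open>f\<close>, but the blocks and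
      the \<open>a i\<close> do not, so one average serves all of \<open>D\<close>.\<close>
    then obtain t where t: "\<And>i. a i \<le> t i" "\<And>i. t i < a (Suc i)"
      "\<And>i. \<bar>blinfun_apply f (step (t i)) - step_limit f\<bar> < e / 2"
      by metis
    have "(\<Sum>i<n. \<bar>blinfun_apply f (step (t i) - step (a i))\<bar>) \<le> norm f * (2 * sqrt (3 * real n))"
    proof (rule sum_abs_blocks_le[where d = "\<lambda>i. step (t i) - step (a i)" and a = a])
      show "norm (step (t i) - step (a i)) \<le> 2" for i
        using norm_triangle_ineq4[of "step (t i)" "step (a i)"] norm_step_le_1[of "t i"]
          norm_step_le_1[of "a i"] by simp
      show "a i \<le> j \<and> j < a (Suc i)" if "james_apply (step (t i) - step (a i)) j \<noteq> 0" for i j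
        using that t(1)[of i] t(2)[of i] by (auto simp: james_apply_simps of_bool_def split: if_splits)
    qed (simp, rule \<open>mono a\<close>)
    also have "\<dots> \<le> B * (2 * sqrt (3 * real n))"
      using B(2)[OF f] by (intro mult_right_mono) simp_all
    also have "\<dots> \<le> e / 2 * real n"
      using n(2) by (simp add: real_sqrt_mult mult_ac)
    finally have blocks: "(\<Sum>i<n. \<bar>blinfun_apply f (step (t i) - step (a i))\<bar>) \<le> e / 2 * real n" .
    have "real n * \<bar>blinfun_apply f v - step_limit f\<bar> = \<bar>\<Sum>i<n. f (step (a i)) - step_limit f\<bar>"
    proof -
      have "real n * (f v - step_limit f) = (\<Sum>i<n. f (step (a i)) - step_limit f)"
        using n(1) by (simp add: v_def blinfun.sum_right blinfun.scaleR_right sum_subtractf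
            right_diff_distrib flip: sum_divide_distrib)
      then show ?thesis
        by (metis abs_mult abs_of_nat)
    qed
    also have "\<dots> \<le> (\<Sum>i<n. \<bar>blinfun_apply f (step (t i) - step (a i))\<bar> + e / 2)"
    proof (rule order_trans[OF sum_abs sum_mono])
      show "\<bar>blinfun_apply f (step (a i)) - step_limit f\<bar> \<le> \<bar>blinfun_apply f (step (t i) - step (a i))\<bar> + e / 2" for i
        using t(3)[of i] unfolding blinfun.diff_right by linarith
    qed
    also have "\<dots> \<le> real n * e"
      using blocks unfolding sum.distrib by (simp add: field_simps)
    finally show "\<bar>blinfun_apply f v - step_limit f\<bar> \<le> e"
      using n(1) by (simp only: mult_le_cancel_left_pos of_nat_0_less_iff)
  qed
qed

text \<open>Recursion: each average is sought from the index at which the previous block ends, with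
  its own tolerance.\<close>

lemma weakly_compact_averages_near_limit:
  fixes D :: "(james \<Rightarrow>\<^sub>L real) set"
  assumes "weakly_compact D" "\<And>k :: nat. 0 < e k"
  obtains a u where "strict_mono a" "\<And>k. u k \<in> convex hull (step ` {a k..<a (Suc k)})"
    "\<And>(f :: james \<Rightarrow>\<^sub>L real) k. f \<in> D \<Longrightarrow> \<bar>blinfun_apply f (u k) - step_limit f\<bar> \<le> e k"
proof -
  have "\<forall>k N. \<exists>b v. N < b \<and> v \<in> convex hull (step ` {N..<b}) \<and> (\<forall>f\<in>D. \<bar>blinfun_apply f v - step_limit f\<bar> \<le> e k)"
    using weakly_compact_average_near_limit[OF assms(1) assms(2)] by metis
  then obtain b v where bv: "\<And>k N. N < b k N" "\<And>k N. v k N \<in> convex hull (step ` {N..<b k N})"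
    "\<And>k N (f :: james \<Rightarrow>\<^sub>L real). f \<in> D \<Longrightarrow> \<bar>blinfun_apply f (v k N) - step_limit f\<bar> \<le> e k"
    by metis
  define a where "a = rec_nat 0 b"
  have a_Suc: "a (Suc k) = b k (a k)" for k
    by (simp add: a_def)
  show thesis
  proof (rule that)
    show "strict_mono a"
      unfolding strict_mono_Suc_iff a_Suc using bv(1) by blast
    show "v k (a k) \<in> convex hull (step ` {a k..<a (Suc k)})" for k
      unfolding a_Suc by (rule bv(2))
  qed (rule bv(3))
qed

section \<open>Weakly compact operators between duals\<close>

text \<open>Point evaluations already separate functionals. Compact images of the ball are then
  weakly closed, so taking the closure in \<open>weakly_compact_operator\<close> does not enlarge
  them.\<close>

lemma Hausdorff_weak_topology_dual:
  "Hausdorff_space (weak_topology :: ('a::real_normed_vector \<Rightarrow>\<^sub>L real) topology)"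
  unfolding Hausdorff_space_def
proof (intro allI impI)
  fix f g :: "'a \<Rightarrow>\<^sub>L real"
  assume "f \<in> topspace weak_topology \<and> g \<in> topspace weak_topology \<and> f \<noteq> g"
  then obtain x where x: "f x \<noteq> g x"
    using blinfun_eqI by blast
  obtain E :: "('a \<Rightarrow>\<^sub>L real) \<Rightarrow>\<^sub>L real" where E: "\<And>f. E f = f x"
    using evaluation_functional by blast
  obtain U V where UV: "open U" "open V" "f x \<in> U" "g x \<in> V" "U \<inter> V = {}"
    using hausdorff[OF x] by blast
  show "\<exists>U V. openin weak_topology U \<and> openin weak_topology V \<and> f \<in> U \<and> g \<in> V \<and> disjnt U V"
    using UV by (intro exI[of _ "blinfun_apply E -` U"] exI[of _ "blinfun_apply E -` V"])
      (auto simp: openin_weak_topology E disjnt_def)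
qed

text \<open>
  The hypothesis says that \<open>V\<close> is continuous from the weak-star to the weak topology; by Tychonoff's
  theorem the dual unit ball, with the topology of pointwise convergence, is compact.
\<close>

lemma weakly_compact_operatorI:
  fixes V :: "('a::real_normed_vector \<Rightarrow>\<^sub>L real) \<Rightarrow>\<^sub>L ('b::real_normed_vector \<Rightarrow>\<^sub>L real)"
  assumes V: "\<And>F. \<exists>y. \<forall>f. blinfun_apply F (V f) = f y"
  shows "weakly_compact_operator V"
proof -
  \<comment> \<open>The dual unit ball as a set of plain functions, on which pointwise convergence
    is the product topology.\<close>
  define K where "K = {\<phi> :: 'a \<Rightarrow> real. (\<forall>x. \<bar>\<phi> x\<bar> \<le> norm x) \<and> (\<forall>x y. \<phi> (x + y) = \<phi> x + \<phi> y)
      \<and> (\<forall>r x. \<phi> (r *\<^sub>R x) = r * \<phi> x)}"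
  define \<psi> where "\<psi> = (\<lambda>\<phi>. V (Blinfun \<phi>))"
  have blinfun_K: "Blinfun \<phi> x = \<phi> x" if "\<phi> \<in> K" for \<phi> x
  proof -
    have "bounded_linear \<phi>"
      using that by (intro bounded_linear_intro[where K = 1]) (auto simp: K_def)
    then show ?thesis
      by (simp add: bounded_linear_Blinfun_apply)
  qed
  have "compact K"
  proof -
    have "compactin (product_topology (\<lambda>_. euclidean) UNIV) (Pi\<^sub>E (UNIV :: 'a set) (\<lambda>x. {- norm x..norm x}))"
      by (simp add: compactin_PiE)
    then have "compact (Pi\<^sub>E (UNIV :: 'a set) (\<lambda>x. {- norm x..norm x}))"
      by (simp add: euclidean_product_topology)
    moreover have "closed {\<phi> :: 'a \<Rightarrow> real. (\<forall>x y. \<phi> (x + y) = \<phi> x + \<phi> y) \<and> (\<forall>r x. \<phi> (r *\<^sub>R x) = r * \<phi> x)}"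
      by (intro closed_Collect_conj closed_Collect_all closed_Collect_eq continuous_intros
          continuous_on_product_coordinates)
    moreover have "K = Pi\<^sub>E UNIV (\<lambda>x. {- norm x..norm x})
        \<inter> {\<phi>. (\<forall>x y. \<phi> (x + y) = \<phi> x + \<phi> y) \<and> (\<forall>r x. \<phi> (r *\<^sub>R x) = r * \<phi> x)}"
      by (auto simp: K_def PiE_iff abs_le_iff minus_le_iff)
    ultimately show ?thesis
      by (simp only: compact_Int_closed)
  qed
  have "continuous_map (top_of_set K) weak_topology \<psi>"
    unfolding weak_topology_def
  proof (rule continuous_on_generated_topo)
    fix S assume "S \<in> {blinfun_apply F -` U |(F :: ('b \<Rightarrow>\<^sub>L real) \<Rightarrow>\<^sub>L real) U. open U}"
    then obtain F :: "('b \<Rightarrow>\<^sub>L real) \<Rightarrow>\<^sub>L real" and U where S: "S = blinfun_apply F -` U" "open U"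
      by blast
    obtain y where y: "\<And>f. F (V f) = f y"
      using V by blast
    have "\<psi> -` S \<inter> topspace (top_of_set K) = K \<inter> (\<lambda>\<phi>. \<phi> y) -` U"
      by (auto simp: S \<psi>_def y blinfun_K)
    moreover have "open ((\<lambda>\<phi> :: 'a \<Rightarrow> real. \<phi> y) -` U)"
      using S(2) by (intro open_vimage continuous_on_product_coordinates)
    ultimately show "openin (top_of_set K) (\<psi> -` S \<inter> topspace (top_of_set K))"
      by (metis openin_open)
  qed (auto intro!: exI[of _ UNIV])
  then have "compactin weak_topology (\<psi> ` K)"
    using \<open>compact K\<close> by (intro image_compactin[of "top_of_set K"]) simp_all
  also have "\<psi> ` K = blinfun_apply V ` cball 0 1"
  proof (intro equalityI subsetI)
    fix g assume "g \<in> \<psi> ` K"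
    then obtain \<phi> where \<phi>: "\<phi> \<in> K" "g = V (Blinfun \<phi>)"
      by (auto simp: \<psi>_def)
    have "norm (Blinfun \<phi>) \<le> 1"
      by (rule norm_blinfun_bound) (use \<phi> in \<open>simp_all add: blinfun_K\<close>, simp add: K_def)
    then show "g \<in> blinfun_apply V ` cball 0 1"
      using \<phi>(2) by simp
  next
    fix g assume "g \<in> blinfun_apply V ` cball 0 1"
    then obtain f where f: "norm f \<le> 1" "g = V f"
      by auto
    have "\<bar>blinfun_apply f x\<bar> \<le> norm x" for x
      using order_trans[OF norm_blinfun[of f x] mult_left_le_one_le[OF _ _ f(1)]] by simp
    then have "blinfun_apply f \<in> K"
      by (simp add: K_def blinfun.add_right blinfun.scaleR_right)
    then show "g \<in> \<psi> ` K"
      using f(2) by (auto simp: \<psi>_def blinfun_apply_inverse intro!: image_eqI[of _ _ "blinfun_apply f"])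
  qed
  finally have compact: "compactin weak_topology (blinfun_apply V ` cball 0 1)" .
  then have "closedin weak_topology (blinfun_apply V ` cball 0 1)"
    by (rule compactin_imp_closedin[OF Hausdorff_weak_topology_dual])
  then show ?thesis
    using compact by (simp add: weakly_compact_operator_def weakly_compact_def closure_of_closedin)
qed

section \<open>The approximating operator\<close>

text \<open>Consecutive values \<open>f (u k)\<close> lie near the same limit and differ by at most
  \<open>2 * c / 2 ^ k\<close>; the geometric series supplies another factor 2.\<close>

lemma norm_compose_interpolation_le:
  fixes f :: "james \<Rightarrow>\<^sub>L real" and T :: "james \<Rightarrow>\<^sub>L james"
  assumes T: "\<And>X. (\<lambda>K. \<Sum>k<K. james_apply X k *\<^sub>R (u (Suc k) - u k)) \<longlonglongrightarrow> T X"
    and u: "\<And>k. \<bar>f (u k) - step_limit f\<bar> \<le> c / 2 ^ k" and "0 \<le> c"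
  shows "norm (f o\<^sub>L T) \<le> 4 * c"
proof (rule norm_blinfun_bound)
  fix X
  have "\<bar>f (\<Sum>k<K. james_apply X k *\<^sub>R (u (Suc k) - u k))\<bar> \<le> 4 * c * norm X" for K
  proof -
    have "\<bar>f (\<Sum>k<K. james_apply X k *\<^sub>R (u (Suc k) - u k))\<bar>
        \<le> (\<Sum>k<K. \<bar>james_apply X k\<bar> * \<bar>f (u (Suc k)) - f (u k)\<bar>)"
      by (simp add: blinfun.sum_right blinfun.scaleR_right blinfun.diff_right sum_abs flip: abs_mult)
    also have "\<dots> \<le> (\<Sum>k<K. norm X * (2 * c * (1 / 2) ^ k))"
    proof (rule sum_mono)
      fix k
      have "c / 2 ^ Suc k \<le> c / 2 ^ k"
        using \<open>0 \<le> c\<close> by (simp add: field_simps)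
      then have "\<bar>f (u (Suc k)) - f (u k)\<bar> \<le> 2 * (c / 2 ^ k)"
        using u[of k] u[of "Suc k"] by linarith
      then show "\<bar>james_apply X k\<bar> * \<bar>f (u (Suc k)) - f (u k)\<bar> \<le> norm X * (2 * c * (1 / 2) ^ k)"
        by (intro mult_mono abs_james_apply_le) (simp_all add: power_one_over)
    qed
    also have "\<dots> = norm X * (2 * c) * (\<Sum>k<K. (1 / 2) ^ k)"
      by (simp add: sum_distrib_left mult_ac)
    also have "\<dots> \<le> norm X * (2 * c) * 2"
    proof (rule mult_left_mono)
      show "(\<Sum>k<K. (1 / 2 :: real) ^ k) \<le> 2"
        using geometric_sum[of "1 / 2 :: real" K] zero_le_power[of "1 / 2 :: real" K] by simp
    qed (use \<open>0 \<le> c\<close> in simp)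
    finally show ?thesis
      by (simp add: mult_ac)
  qed
  moreover have "(\<lambda>K. \<bar>f (\<Sum>k<K. james_apply X k *\<^sub>R (u (Suc k) - u k))\<bar>) \<longlonglongrightarrow> \<bar>f (T X)\<bar>"
    by (intro tendsto_intros T)
  ultimately have "\<bar>f (T X)\<bar> \<le> 4 * c * norm X"
    by (intro LIMSEQ_le_const2) auto
  then show "norm ((f o\<^sub>L T) X) \<le> 4 * c * norm X"
    by simp
qed (use \<open>0 \<le> c\<close> in simp)

lemma weakly_compact_approximation:
  fixes D :: "(james \<Rightarrow>\<^sub>L real) set"
  assumes "weakly_compact D" "0 < \<epsilon>"
  obtains V :: "(james \<Rightarrow>\<^sub>L real) \<Rightarrow>\<^sub>L (james \<Rightarrow>\<^sub>L real)"
  where "weakly_compact_operator V" "\<And>f. f \<in> D \<Longrightarrow> norm (f - V f) \<le> \<epsilon>" "norm V \<le> 5"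
proof -
  \<comment> \<open>Dividing by 4 offsets the factor in
    \<open>norm_compose_interpolation_le\<close>.\<close>
  obtain a u where a: "strict_mono a" and u: "\<And>k. u k \<in> convex hull (step ` {a k..<a (Suc k)})"
    and near: "\<And>(f :: james \<Rightarrow>\<^sub>L real) k. f \<in> D \<Longrightarrow> \<bar>blinfun_apply f (u k) - step_limit f\<bar> \<le> \<epsilon> / 4 / 2 ^ k"
    using weakly_compact_averages_near_limit[OF assms(1), of "\<lambda>k. \<epsilon> / 4 / 2 ^ k"] assms(2) by auto
  obtain T :: "james \<Rightarrow>\<^sub>L james" where "norm T \<le> 4"
    and T: "\<And>X. (\<lambda>K. \<Sum>k<K. james_apply X k *\<^sub>R (u (Suc k) - u k)) \<longlonglongrightarrow> T X"
    using interpolation_operator[OF a u] by blast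
  define V where "V = Blinfun (\<lambda>f :: james \<Rightarrow>\<^sub>L real. f - (f o\<^sub>L T))"
  have V: "V f = f - (f o\<^sub>L T)" for f
    unfolding V_def by (simp add: bounded_linear_Blinfun_apply bounded_linear_sub bounded_linear_ident
      bounded_bilinear.bounded_linear_left[OF bounded_bilinear_blinfun_compose])
  show thesis
  proof (rule that)
    show "weakly_compact_operator V"
    proof (rule weakly_compact_operatorI)
      fix F :: "(james \<Rightarrow>\<^sub>L real) \<Rightarrow>\<^sub>L real"
      obtain Y where "\<And>f. F (f - (f o\<^sub>L T)) = f Y"
        using bidual_interpolation_remainder[OF a u T] by blast
      then show "\<exists>Y. \<forall>f. F (V f) = f Y"
        by (auto simp: V)
    qed
    show "norm (f - V f) \<le> \<epsilon>" if "f \<in> D" for f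
      using norm_compose_interpolation_le[of u T f "\<epsilon> / 4", OF T near[OF that]] assms(2) by (simp add: V)
    show "norm V \<le> 5"
    proof (rule norm_blinfun_bound)
      fix f :: "james \<Rightarrow>\<^sub>L real"
      have "norm (f o\<^sub>L T) \<le> norm f * 4"
        using norm_blinfun_compose[of f T] mult_left_mono[OF \<open>norm T \<le> 4\<close>, of "norm f"] by simp
      then show "norm (V f) \<le> 5 * norm f"
        using norm_triangle_ineq4[of f "f o\<^sub>L T"] by (simp add: V)
    qed simp
  qed
qed

theorem theorem3p3:
  shows "WAP TYPE(james \<Rightarrow>\<^sub>L real)"
  unfolding WAP_def
proof (intro exI[of _ 5] allI impI)
  fix D :: "(james \<Rightarrow>\<^sub>L real) set" and \<epsilon> :: real
  assume "weakly_compact D" "0 < \<epsilon>"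
  \<comment> \<open>Half of the tolerance leaves room for the strict inequality, since a supremum
    preserves only weak ones.\<close>
  then obtain V :: "(james \<Rightarrow>\<^sub>L real) \<Rightarrow>\<^sub>L (james \<Rightarrow>\<^sub>L real)" where V: "weakly_compact_operator V"
    "\<And>f. f \<in> D \<Longrightarrow> norm (f - V f) \<le> \<epsilon> / 2" "norm V \<le> 5"
    using weakly_compact_approximation[of D "\<epsilon> / 2"] by (metis half_gt_zero)
  have "(SUP f\<in>D. ereal (norm (f - V f))) \<le> ereal (\<epsilon> / 2)"
    using V(2) by (intro SUP_least) simp
  also have "\<dots> < ereal \<epsilon>"
    using \<open>0 < \<epsilon>\<close> by simp
  finally show "\<exists>V :: (james \<Rightarrow>\<^sub>L real) \<Rightarrow>\<^sub>L (james \<Rightarrow>\<^sub>L real). weakly_compact_operator V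
      \<and> (SUP f\<in>D. ereal (norm (f - V f))) < ereal \<epsilon> \<and> norm V \<le> 5"
    using V by blast
qed

end
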